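(* Let $F:\mathcal{G}_{\mathrm{prob}}\to\mathbb{R}$ satisfy: (P1) for every nonempty graph $G$ the map $P\mapsto F(G,P)$ is concave on $\mathcal{P}(V(G))$; (P2) for nonempty graphs $G,H$ and $P\in\mathcal{P}(V(G)\times V(H))$ with marginals $P_G,P_H$, $F(G\boxtimes H,P)\le F(G,P_G)+F(H,P_H)\le F(G\boxtimes H,P)+H(P_G)+H(P_H)-H(P)$; (P3) for nonempty graphs $G,H$, $P_G\in\mathcal{P}(V(G))$, $P_H\in\mathcal{P}(V(H))$, $p\in[0,1]$: $F(G\sqcup H,pP_G\oplus(1-p)P_H)=pF(G,P_G)+(1-p)F(H,P_H)+h(p)$; (P4) if $\varphi:\overline{H}\to\overline{G}$ is a homomorphism and $P\in\mathcal{P}(V(H))$ then $F(H,P)\le F(G,\varphi_*(P))$. Define $f:\mathcal{G}\to\mathbb{R}_{\ge0}$ by $f(G)=\max_{P\in\mathcal{P}(V(G))}2^{F(G,P)}$ if $G$ is nonempty and $f(G)=0$ if $G$ is empty. Then $f\in\Delta(\mathcal{G})$, and for every probabilistic graph $(G,P)$, \[F(G,P)=\log\lim_{\epsilon\to0}\limsup_{n\to\infty}\sqrt[n]{f\big(G^{\boxtimes n}[T^n_{B_\epsilon(P)}]\big)}.\]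
   Context: All graphs are finite simple undirected. $\overline{G}$ is the complement; $G\sqcup H$ disjoint union; $G\boxtimes H$ the strong product (vertex set $V(G)\times V(H)$, distinct $(g,h),(g',h')$ adjacent iff ($g=g'$ or $\{g,g'\}\in E(G)$) and ($h=h'$ or $\{h,h'\}\in E(H)$)); $G^{\boxtimes n}$ the $n$-fold strong power; $G[S]$ induced subgraph; $K_1$ the one-vertex graph. $\mathcal{G}$ is the set of isomorphism classes of graphs. $\Delta(\mathcal{G})$ is the set of $f:\mathcal{G}\to\mathbb{R}_{\ge0}$ with, for all $G,H$: $f(G\sqcup H)=f(G)+f(H)$; $f(G\boxtimes H)=f(G)f(H)$; if there is a homomorphism $\overline{H}\to\overline{G}$ then $f(H)\le f(G)$; $f(K_1)=1$. A probabilistic graph is $(G,P)$ with $G$ nonempty and $P$ a probability distribution on $V(G)$; $\mathcal{G}_{\mathrm{prob}}$ is the set of isomorphism classes (measure-preserving isomorphisms) of these. $\mathcal{P}(\mathcal{X})$ is the set of probability distributions on a finite set $\mathcal{X}$; an $n$-type is $P$ with $nP(x)\in\mathbb{N}$ for all $x$; $T^n_P\subseteq\mathcal{X}^n$ is the set of strings with exactly $nP(x)$ occurrences of each $x$; $T^n_{\mathcal{U}}$ is the union of $T^n_P$ over $n$-types $P\in\mathcal{U}$; $B_\epsilon(P)$ is the open total-variation $\epsilon$-ball. $H$ is Shannon entropy (log base 2), $h$ the binary entropy. $pP_G\oplus(1-p)P_H$ is the distribution on $V(G)\sqcup V(H)$ equal to $pP_G$ on $V(G)$ and $(1-p)P_H$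 on $V(H)$; $\varphi_*$ is pushforward; marginals of $P$ on $V(G)\times V(H)$ are $P_G,P_H$. *)

theory Defs
  imports "HOL-Probability.Probability" "Graph_Theory.Pair_Digraph"
begin

text \<open>
  A finite simple undirected graph is a record \<open>G :: 'a pair_pre_digraph\<close> with \<open>pair_graph G\<close>:
  finite vertex set \<open>pverts G\<close>, and a symmetric irreflexive arc relation \<open>parcs G\<close> on it, in which
  an undirected edge is represented by its two orientations. The empty graph is allowed.
\<close>

section \<open>Graph operations\<close>

definition graph_compl :: "'a pair_pre_digraph \<Rightarrow> 'a pair_pre_digraph" where
  "graph_compl G = \<lparr>pverts = pverts G,
     parcs = {(u, v) \<in> pverts G \<times> pverts G. u \<noteq> v \<and> (u, v) \<notin> parcs G}\<rparr>"

definition disjoint_sum :: "'a pair_pre_digraph \<Rightarrow> 'b pair_pre_digraph \<Rightarrow> ('a + 'b) pair_pre_digraph"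
    (infixl "\<squnion>\<^sub>G" 65) where
  "G \<squnion>\<^sub>G H = \<lparr>pverts = pverts G <+> pverts H,
     parcs = {(Inl u, Inl v) |u v. (u, v) \<in> parcs G} \<union> {(Inr u, Inr v) |u v. (u, v) \<in> parcs H}\<rparr>"

definition strong_product :: "'a pair_pre_digraph \<Rightarrow> 'b pair_pre_digraph \<Rightarrow> ('a \<times> 'b) pair_pre_digraph"
    (infixl "\<boxtimes>" 70) where
  "G \<boxtimes> H = \<lparr>pverts = pverts G \<times> pverts H,
     parcs = {((g, h), (g', h')) |g h g' h'.
       g \<in> pverts G \<and> g' \<in> pverts G \<and> h \<in> pverts H \<and> h' \<in> pverts H \<and> (g, h) \<noteq> (g', h') \<and>
       (g = g' \<or> (g, g') \<in> parcs G) \<and> (h = h' \<or> (h, h') \<in> parcs H)}\<rparr>"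

text \<open>The vertices of the \<open>n\<close>-fold strong power are the strings of length \<open>n\<close> over the vertex set.\<close>

definition strings :: "nat \<Rightarrow> 'a set \<Rightarrow> 'a list set" where
  "strings n X = {xs. length xs = n \<and> set xs \<subseteq> X}"

definition strong_power :: "'a pair_pre_digraph \<Rightarrow> nat \<Rightarrow> 'a list pair_pre_digraph" where
  "strong_power G n = \<lparr>pverts = strings n (pverts G),
     parcs = {(xs, ys). xs \<in> strings n (pverts G) \<and> ys \<in> strings n (pverts G) \<and> xs \<noteq> ys \<and>
       (\<forall>i<n. xs ! i = ys ! i \<or> (xs ! i, ys ! i) \<in> parcs G)}\<rparr>"

definition induced_subgraph_on :: "'a pair_pre_digraph \<Rightarrow> 'a set \<Rightarrow> 'a pair_pre_digraph" where
  "induced_subgraph_on G S = \<lparr>pverts = pverts G \<inter> S, parcs = parcs G \<inter> (S \<times> S)\<rparr>"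

definition K1 :: "nat pair_pre_digraph" where
  "K1 = \<lparr>pverts = {0}, parcs = {}\<rparr>"

definition graph_hom :: "('a \<Rightarrow> 'b) \<Rightarrow> 'a pair_pre_digraph \<Rightarrow> 'b pair_pre_digraph \<Rightarrow> bool" where
  "graph_hom \<phi> G H \<longleftrightarrow>
     \<phi> \<in> pverts G \<rightarrow> pverts H \<and> (\<forall>(u, v) \<in> parcs G. (\<phi> u, \<phi> v) \<in> parcs H)"

definition graph_iso :: "('a \<Rightarrow> 'b) \<Rightarrow> 'a pair_pre_digraph \<Rightarrow> 'b pair_pre_digraph \<Rightarrow> bool" where
  "graph_iso \<phi> G H \<longleftrightarrow> bij_betw \<phi> (pverts G) (pverts H) \<and>
     (\<forall>u\<in>pverts G. \<forall>v\<in>pverts G. (u, v) \<in> parcs G \<longleftrightarrow> (\<phi> u, \<phi> v) \<in> parcs H)"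

section \<open>Probability distributions on finite sets\<close>

text \<open>
  A distribution on \<open>X\<close> is a \<open>pmf\<close> on the ambient type whose support lies in \<open>X\<close>. Pushforwards and
  marginals are then given by \<open>map_pmf\<close>.
\<close>

definition dists :: "'a set \<Rightarrow> 'a pmf set" where
  "dists X = {P. set_pmf P \<subseteq> X}"

definition mix_pmf :: "real \<Rightarrow> 'a pmf \<Rightarrow> 'a pmf \<Rightarrow> 'a pmf" where
  "mix_pmf p P Q = bind_pmf (bernoulli_pmf p) (\<lambda>b. if b then P else Q)"

lemma pmf_mix_pmf:
  assumes "0 \<le> p" "p \<le> 1"
  shows "pmf (mix_pmf p P Q) x = p * pmf P x + (1 - p) * pmf Q x"
  using assms by (simp add: mix_pmf_def pmf_bind)

definition oplus_pmf :: "real \<Rightarrow> 'a pmf \<Rightarrow> 'b pmf \<Rightarrow> ('a + 'b) pmf" where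
  "oplus_pmf p P Q = mix_pmf p (map_pmf Inl P) (map_pmf Inr Q)"

definition shannon_entropy :: "'a pmf \<Rightarrow> real" where
  "shannon_entropy P = - (\<Sum>x\<in>set_pmf P. pmf P x * log 2 (pmf P x))"

text \<open>The convention \<open>0 log 0 = 0\<close> holds automatically, since the factor in front vanishes.\<close>

definition binary_entropy :: "real \<Rightarrow> real" where
  "binary_entropy p = - p * log 2 p - (1 - p) * log 2 (1 - p)"

text \<open>Total variation distance (half the \<open>\<ell>\<^sup>1\<close> distance), for distributions of finite support.\<close>

definition tv_dist :: "'a pmf \<Rightarrow> 'a pmf \<Rightarrow> real" where
  "tv_dist P Q = (\<Sum>x\<in>set_pmf P \<union> set_pmf Q. \<bar>pmf P x - pmf Q x\<bar>) / 2"

definition tv_ball :: "'a set \<Rightarrow> real \<Rightarrow> 'a pmf \<Rightarrow> 'a pmf set" where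
  "tv_ball X \<epsilon> P = {Q \<in> dists X. tv_dist P Q < \<epsilon>}"

definition is_ntype :: "nat \<Rightarrow> 'a set \<Rightarrow> 'a pmf \<Rightarrow> bool" where
  "is_ntype n X P \<longleftrightarrow> P \<in> dists X \<and> (\<forall>x\<in>X. real n * pmf P x \<in> \<nat>)"

definition strings_of_type :: "nat \<Rightarrow> 'a set \<Rightarrow> 'a pmf \<Rightarrow> 'a list set" where
  "strings_of_type n X P = {xs \<in> strings n X. \<forall>x\<in>X. real (count_list xs x) = real n * pmf P x}"

definition strings_of_types :: "nat \<Rightarrow> 'a set \<Rightarrow> 'a pmf set \<Rightarrow> 'a list set" where
  "strings_of_types n X U = (\<Union>P\<in>{P \<in> U. is_ntype n X P}. strings_of_type n X P)"

section \<open>Isomorphism classes\<close>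

text \<open>
  An isomorphism class is represented by the set of its members whose vertices are natural numbers.
  Since every finite graph is isomorphic to one on a set of natural numbers, this gives a single
  type of classes in which \<open>gclass G\<close> and \<open>pgclass G P\<close> make sense (and are nonempty) for graphs
  over an arbitrary vertex type, in particular for sums, products and powers.
\<close>

type_synonym graph_class = "nat pair_pre_digraph set"
type_synonym prob_graph_class = "(nat pair_pre_digraph \<times> nat pmf) set"

definition gclass :: "'a pair_pre_digraph \<Rightarrow> graph_class" where
  "gclass G = {H. pair_graph H \<and> (\<exists>\<phi>. graph_iso \<phi> G H)}"

definition pgclass :: "'a pair_pre_digraph \<Rightarrow> 'a pmf \<Rightarrow> prob_graph_class" where
  "pgclass G P = {(H, Q). pair_graph H \<and> Q \<in> dists (pverts H) \<and>
     (\<exists>\<phi>. graph_iso \<phi> G H \<and> map_pmf \<phi> P = Q)}"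

section \<open>The asymptotic spectrum of graphs and the functional induced by \<open>F\<close>\<close>

text \<open>
  Functions on isomorphism classes are total in HOL; only their values on classes \<open>gclass G\<close>
  (respectively \<open>pgclass G P\<close>) of graphs matter below. Restricting the quantifiers to graphs on
  natural numbers loses nothing, as these represent all classes.
\<close>

definition asymptotic_spectrum :: "(graph_class \<Rightarrow> real) set" where
  "asymptotic_spectrum = {f.
     (\<forall>G :: nat pair_pre_digraph. pair_graph G \<longrightarrow> 0 \<le> f (gclass G)) \<and>
     (\<forall>(G :: nat pair_pre_digraph) (H :: nat pair_pre_digraph). pair_graph G \<longrightarrow> pair_graph H \<longrightarrow>
        f (gclass (G \<squnion>\<^sub>G H)) = f (gclass G) + f (gclass H) \<and>
        f (gclass (G \<boxtimes> H)) = f (gclass G) * f (gclass H) \<and>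
        ((\<exists>\<phi>. graph_hom \<phi> (graph_compl H) (graph_compl G)) \<longrightarrow> f (gclass H) \<le> f (gclass G))) \<and>
     f (gclass K1) = 1}"

text \<open>
  \<open>GREATEST\<close> is the maximum of a possibly infinite set of reals; it is unspecified if there is none.
  The values \<open>F (pgclass G P)\<close> do not depend on which representative \<open>G\<close> of the class \<open>C\<close> is used.
\<close>

definition induced_functional :: "(prob_graph_class \<Rightarrow> real) \<Rightarrow> graph_class \<Rightarrow> real" where
  "induced_functional F C =
     (if \<exists>G\<in>C. pverts G = {} then 0
      else GREATEST y. y \<in> {2 powr F (pgclass G P) |G P. G \<in> C \<and> P \<in> dists (pverts G)})"

end

theory Submission
  imports Defs "HOL-Real_Asymp.Real_Asymp"
begin

text \<open>
  Two estimates carry the argument. Apart from concavity, \<open>F\<close> is almost convex: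
  \<open>F(G, tP + (1-t)Q) \<le> t F(G, P) + (1-t) F(G, Q) + h(t)\<close>, by (P2) on \<open>G \<squnion> G = G \<boxtimes> (K1 \<squnion> K1)\<close> and (P3).
  Hence \<open>F\<close> is uniformly continuous in \<open>P\<close>, so the maximum exists, and \<open>f \<in> \<Delta>\<close> follows from (P2)-(P4) and
  Gibbs' variational formula \<open>max\<^sub>p (pa + (1-p)b + h(p)) = log(2\<^sup>a + 2\<^sup>b)\<close>.
  Moreover \<open>F(G\<^sup>n, Q) \<le> n F(G, R)\<close>, where \<open>R\<close> is the average of the marginals of \<open>Q\<close>. If \<open>Q\<close> lives on
  strings with type near \<open>P\<close>, then \<open>R\<close> is near \<open>P\<close>, which gives the upper bound. For the lower bound,
  \<open>F(G\<^sup>n, P\<^sup>n) \<ge> n F(G, P)\<close>; by the law of large numbers \<open>P\<^sup>n\<close> is concentrated on these strings, and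
  almost convexity shows that conditioning on them costs only \<open>o(n)\<close>.
\<close>

section \<open>Distributions and entropy on finite sets\<close>

text \<open>Concavity alone gives no maximum: a concave function on a simplex may jump at the
  boundary, its value there lying below the limits from inside. Almost convexity excludes this. Its
  error \<open>h(t)\<close> does not depend on the graph, so on \<open>G^n\<close> it costs at most
  one bit, which is lost on division by \<open>n\<close>. Continuity also needs bounds on
  \<open>F\<close>. Point masses have \<open>F >= 0\<close> by comparison with \<open>K1\<close>,
  and concavity extends this to all distributions. An upper bound holds because every distribution
  is a component of weight \<open>1/|V(G)|\<close> of the uniform one. On \<open>G^n\<close> this
  bound would carry the factor \<open>|V(G)|^n\<close>; there \<open>n\<close> times the bound for
  \<open>G\<close> is used instead. Finally, \<open>f\<close> is evaluated on induced subgraphs of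
  \<open>G^n\<close> while the estimates live on \<open>G^n\<close> itself. They meet because
  \<open>F\<close> does not see vertices outside the support, a consequence of (P3) and
  (P4).\<close>

lemma map_pmf_mix_pmf: "map_pmf f (mix_pmf t P Q) = mix_pmf t (map_pmf f P) (map_pmf f Q)"
  by (auto simp: mix_pmf_def map_bind_pmf intro!: bind_pmf_cong)

lemma mix_pmf_0 [simp]: "mix_pmf 0 P Q = Q"
  by (rule pmf_eqI) (simp add: pmf_mix_pmf)

lemma mix_pmf_1 [simp]: "mix_pmf 1 P Q = P"
  by (rule pmf_eqI) (simp add: pmf_mix_pmf)

lemma mix_pmf_dists:
  assumes "P \<in> dists X" "Q \<in> dists X"
  shows "mix_pmf t P Q \<in> dists X"
  using assms by (auto simp: dists_def mix_pmf_def split: if_splits)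

lemma map_pmf_dists: "P \<in> dists X \<Longrightarrow> f ` X \<subseteq> Y \<Longrightarrow> map_pmf f P \<in> dists Y"
  by (auto simp: dists_def)

lemma oplus_pmf_dists: "P \<in> dists X \<Longrightarrow> Q \<in> dists Y \<Longrightarrow> oplus_pmf p P Q \<in> dists (X <+> Y)"
  unfolding oplus_pmf_def by (intro mix_pmf_dists map_pmf_dists) auto

lemma map_oplus_pmf:
  "map_pmf (map_sum f g) (oplus_pmf p P Q) = oplus_pmf p (map_pmf f P) (map_pmf g Q)"
  by (simp add: oplus_pmf_def map_pmf_mix_pmf map_pmf_comp)

lemma dists_nonempty: "P \<in> dists X \<Longrightarrow> X \<noteq> {}"
  using set_pmf_not_empty[of P] by (auto simp: dists_def)

section \<open>Splitting and completing mixtures\<close>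

lemma mix_cond_pmf:
  assumes "set_pmf P \<inter> A \<noteq> {}" "set_pmf P \<inter> -A \<noteq> {}"
  shows "mix_pmf (measure_pmf.prob P A) (cond_pmf P A) (cond_pmf P (-A)) = P"
proof (rule pmf_eqI)
  fix x
  have pos: "measure_pmf.prob P A > 0" "measure_pmf.prob P (-A) > 0"
    using assms by (auto simp: measure_pmf_posI)
  have c: "1 - measure_pmf.prob P A = measure_pmf.prob P (-A)"
    using measure_pmf.prob_compl[of A P] by (simp add: Compl_eq_Diff_UNIV)
  show "pmf (mix_pmf (measure_pmf.prob P A) (cond_pmf P A) (cond_pmf P (-A))) x = pmf P x"
    using pos by (simp add: pmf_mix_pmf pmf_cond assms c)
qed

text \<open>The components are the conditional distributions on \<open>A\<close> and on its
  complement. If one of these events has probability zero, conditioning on it is undefined and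
  \<open>P\<close> itself fills the slot of weight zero; hence the guards on the two support
  claims.\<close>

lemma mix_pmf_split:
  fixes A :: "'a set"
  obtains P1 P2 where "P = mix_pmf (measure_pmf.prob P A) P1 P2"
    "measure_pmf.prob P A \<noteq> 0 \<Longrightarrow> set_pmf P1 \<subseteq> set_pmf P \<inter> A"
    "measure_pmf.prob P A \<noteq> 1 \<Longrightarrow> set_pmf P2 \<subseteq> set_pmf P - A"
    "set_pmf P1 \<subseteq> set_pmf P" "set_pmf P2 \<subseteq> set_pmf P"
proof -
  consider "set_pmf P \<inter> A = {}" | "set_pmf P \<inter> -A = {}"
    | "set_pmf P \<inter> A \<noteq> {}" "set_pmf P \<inter> -A \<noteq> {}" by blast
  then show thesis
  proof cases
    case 1
    then have "measure_pmf.prob P A = 0" by (simp add: measure_pmf_zero_iff)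
    with 1 show ?thesis by (intro that[of P P]) auto
  next
    case 2
    then have "measure_pmf.prob P A = 1" by (subst measure_pmf.prob_eq_1) (auto simp: AE_measure_pmf_iff)
    with 2 show ?thesis by (intro that[of P P]) auto
  next
    case 3
    show ?thesis
      by (rule that[of "cond_pmf P A" "cond_pmf P (-A)"]) (use 3 in \<open>auto simp: mix_cond_pmf\<close>)
  qed
qed

lemma sum_pmf_dists: "finite X \<Longrightarrow> P \<in> dists X \<Longrightarrow> (\<Sum>x\<in>X. pmf P x) = 1"
  by (simp add: sum_pmf_eq_1 dists_def)

lemma exists_pmf_finite:
  fixes g :: "'a \<Rightarrow> real"
  assumes "finite X" "\<And>x. x \<in> X \<Longrightarrow> 0 \<le> g x" "(\<Sum>x\<in>X. g x) = 1"
  obtains R where "R \<in> dists X" "\<And>x. x \<in> X \<Longrightarrow> pmf R x = g x"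
proof -
  define g' where "g' x = (if x \<in> X then g x else 0)" for x
  have nn: "\<And>x. 0 \<le> g' x" using assms by (auto simp: g'_def)
  have "(\<integral>\<^sup>+ x. ennreal (g' x) \<partial>count_space UNIV) = (\<Sum>x\<in>X. ennreal (g' x))"
    by (rule nn_integral_count_space'[OF assms(1)]) (auto simp: g'_def)
  also have "\<dots> = ennreal (\<Sum>x\<in>X. g' x)" using nn by (simp add: sum_ennreal)
  also have "(\<Sum>x\<in>X. g' x) = 1" using assms(3) by (simp add: g'_def)
  finally have *: "(\<integral>\<^sup>+ x. ennreal (g' x) \<partial>count_space UNIV) = 1" by simp
  have p: "pmf (embed_pmf g') x = g' x" for x
    by (rule pmf_embed_pmf[OF nn *])
  show thesis
    by (rule that[of "embed_pmf g'"]) (auto simp: dists_def set_pmf_iff p g'_def split: if_splits)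
qed

text \<open>\<open>R\<close> is the remainder \<open>Q - tP\<close>, normalised by its mass
  \<open>1 - t\<close>. This needs \<open>t < 1\<close>, so callers treat the case without remainder
  separately.\<close>

lemma mix_pmf_complement:
  assumes fin: "finite X" and PQ: "P \<in> dists X" "Q \<in> dists X" and t: "0 \<le> t" "t < 1"
    and le: "\<And>x. x \<in> X \<Longrightarrow> t * pmf P x \<le> pmf Q x"
  obtains R where "R \<in> dists X" "Q = mix_pmf t P R"
proof -
  have s: "(\<Sum>x\<in>X. (pmf Q x - t * pmf P x) / (1 - t)) = 1"
    using t sum_pmf_dists[OF fin PQ(1)] sum_pmf_dists[OF fin PQ(2)]
    by (simp add: sum_divide_distrib[symmetric] sum_subtractf sum_distrib_left[symmetric])
  obtain R where R: "R \<in> dists X" "\<And>x. x \<in> X \<Longrightarrow> pmf R x = (pmf Q x - t * pmf P x) / (1 - t)"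
    using exists_pmf_finite[OF fin _ s] le t by auto
  have "Q = mix_pmf t P R"
  proof (rule pmf_eqI)
    fix x
    show "pmf Q x = pmf (mix_pmf t P R) x"
    proof (cases "x \<in> X")
      case True
      then show ?thesis using t R(2)[OF True] by (simp add: pmf_mix_pmf)
    next
      case False
      then have "pmf P x = 0" "pmf Q x = 0" "pmf R x = 0"
        using PQ R(1) by (auto simp: dists_def set_pmf_iff)
      then show ?thesis using t by (simp add: pmf_mix_pmf)
    qed
  qed
  with R(1) show thesis by (rule that)
qed

section \<open>Shannon entropy\<close>

lemma shannon_entropy_superset:
  assumes "finite X" "P \<in> dists X"
  shows "shannon_entropy P = (\<Sum>x\<in>X. - (pmf P x * log 2 (pmf P x)))"
  unfolding shannon_entropy_def sum_negf[symmetric]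
  by (rule sum.mono_neutral_left) (use assms in \<open>auto simp: dists_def set_pmf_iff\<close>)

text \<open>Both entropies are expectations over \<open>P\<close> of a negative logarithm, taken of
  the mass of the fibre through \<open>x\<close> on one side and of \<open>x\<close> on the other. A
  fibre is at least as heavy as each of its points.\<close>

lemma shannon_entropy_map_le:
  assumes fin: "finite (set_pmf P)"
  shows "shannon_entropy (map_pmf f P) \<le> shannon_entropy P"
proof -
  let ?Q = "map_pmf f P"
  have "shannon_entropy ?Q = - measure_pmf.expectation ?Q (\<lambda>y. log 2 (pmf ?Q y))"
    unfolding shannon_entropy_def using fin
    by (subst integral_measure_pmf_real[of "set_pmf ?Q"]) (auto simp: mult.commute)
  also have "\<dots> = - (\<Sum>x\<in>set_pmf P. pmf P x * log 2 (pmf ?Q (f x)))"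
    unfolding integral_map_pmf using fin
    by (subst integral_measure_pmf_real[of "set_pmf P"]) (auto simp: mult.commute)
  also have "\<dots> \<le> - (\<Sum>x\<in>set_pmf P. pmf P x * log 2 (pmf P x))"
  proof -
    have "pmf P x \<le> pmf ?Q (f x)" for x
    proof -
      have "measure_pmf.prob P {x} \<le> measure_pmf.prob P (f -` {f x})"
        by (rule measure_pmf.finite_measure_mono) auto
      then show ?thesis by (simp add: pmf_map measure_pmf_single)
    qed
    then show ?thesis
      by (auto intro!: sum_mono mult_left_mono simp: pmf_positive)
  qed
  finally show ?thesis by (simp add: shannon_entropy_def)
qed

lemma shannon_entropy_map_inj:
  assumes fin: "finite (set_pmf P)" and inj: "inj_on f (set_pmf P)"
  shows "shannon_entropy (map_pmf f P) = shannon_entropy P"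
proof (rule antisym)
  have "map_pmf (inv_into (set_pmf P) f) (map_pmf f P) = P"
    unfolding map_pmf_comp using inj by (intro map_pmf_idI) auto
  then show "shannon_entropy P \<le> shannon_entropy (map_pmf f P)"
    using shannon_entropy_map_le[of "map_pmf f P" "inv_into (set_pmf P) f"] fin by simp
qed (rule shannon_entropy_map_le[OF fin])

lemma shannon_entropy_pair:
  assumes fin: "finite (set_pmf P)" "finite (set_pmf Q)"
  shows "shannon_entropy (pair_pmf P Q) = shannon_entropy P + shannon_entropy Q"
proof -
  have "(\<Sum>z\<in>set_pmf P \<times> set_pmf Q. pmf (pair_pmf P Q) z * log 2 (pmf (pair_pmf P Q) z))
      = (\<Sum>x\<in>set_pmf P. \<Sum>y\<in>set_pmf Q. pmf P x * log 2 (pmf P x) * pmf Q y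
           + pmf P x * (pmf Q y * log 2 (pmf Q y)))"
    unfolding sum.cartesian_product
    by (intro sum.cong) (auto simp: pmf_pair log_mult pmf_positive algebra_simps set_pmf_iff)
  also have "\<dots> = (\<Sum>x\<in>set_pmf P. pmf P x * log 2 (pmf P x)) * (\<Sum>y\<in>set_pmf Q. pmf Q y)
      + (\<Sum>x\<in>set_pmf P. pmf P x) * (\<Sum>y\<in>set_pmf Q. pmf Q y * log 2 (pmf Q y))"
    by (simp only: sum.distrib sum_product)
  finally show ?thesis
    using fin by (simp add: shannon_entropy_def sum_pmf_eq_1)
qed

lemma shannon_entropy_return [simp]: "shannon_entropy (return_pmf x) = 0"
  by (simp add: shannon_entropy_def)

lemma shannon_entropy_oplus_points:
  assumes "0 \<le> t" "t \<le> 1"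
  shows "shannon_entropy (oplus_pmf t (return_pmf a) (return_pmf b)) = binary_entropy t"
proof -
  have d: "oplus_pmf t (return_pmf a) (return_pmf b) \<in> dists {Inl a, Inr b}"
    unfolding oplus_pmf_def by (intro mix_pmf_dists) (auto simp: dists_def)
  show ?thesis
    using assms by (subst shannon_entropy_superset[OF _ d])
      (auto simp: oplus_pmf_def pmf_mix_pmf binary_entropy_def)
qed

section \<open>Binary entropy and the variational formula\<close>

lemma binary_entropy_0 [simp]: "binary_entropy 0 = 0"
  and binary_entropy_1 [simp]: "binary_entropy 1 = 0"
  by (simp_all add: binary_entropy_def)

lemma gibbs_binary:
  assumes p: "0 \<le> p" "p \<le> 1"
  shows "p * a + (1 - p) * b + binary_entropy p \<le> log 2 (2 powr a + 2 powr b)"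
proof -
  define S where "S = (2::real) powr a + 2 powr b"
  have S: "S > 0" by (simp add: S_def add_pos_pos)
  \<comment> \<open>This is \<open>ln y <= y - 1\<close> at \<open>y = 2^c / (qS)\<close>,
    multiplied by \<open>q\<close>. The right-hand sides for \<open>(p, a)\<close> and
    \<open>(1 - p, b)\<close> add up to zero, since both \<open>2^a/S + 2^b/S\<close> and
    \<open>p + (1 - p)\<close> equal 1.\<close>
  have "q * c - q * log 2 q - q * log 2 S \<le> (2 powr c / S - q) / ln 2" if "q \<ge> 0" for q c :: real
  proof (cases "q = 0")
    case True
    then show ?thesis using S by simp
  next
    case False
    with that have q: "q > 0" by simp
    have "ln (2 powr c / (q * S)) \<le> 2 powr c / (q * S) - 1"
      using q S by (intro ln_le_minus_one) auto
    then have "q * ln (2 powr c / (q * S)) \<le> q * (2 powr c / (q * S) - 1)"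
      using q by (intro mult_left_mono) auto
    also have "\<dots> = 2 powr c / S - q" using q S by (simp add: field_simps)
    also have "ln (2 powr c / (q * S)) = c * ln 2 - ln q - ln S"
      using q S by (simp add: ln_div ln_mult ln_powr)
    finally have "q * (c * ln 2 - ln q - ln S) / ln 2 \<le> (2 powr c / S - q) / ln 2"
      by (intro divide_right_mono) auto
    moreover have "q * (c * ln 2 - ln q - ln S) / ln 2 = q * c - q * log 2 q - q * log 2 S"
      by (simp add: log_def field_simps)
    ultimately show ?thesis by simp
  qed
  from this[of p a] this[of "1 - p" b] p
  have "p * a + (1 - p) * b + binary_entropy p - log 2 S
      \<le> (2 powr a / S - p) / ln 2 + (2 powr b / S - (1 - p)) / ln 2"
    by (simp add: binary_entropy_def algebra_simps)
  also have "\<dots> = ((2 powr a + 2 powr b) / S - 1) / ln 2"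
    by (simp add: diff_divide_distrib add_divide_distrib)
  also have "\<dots> = 0" using S by (simp add: S_def)
  finally show ?thesis by (simp add: S_def)
qed

text \<open>With weights proportional to \<open>2^a\<close> and \<open>2^b\<close>, both
  \<open>a - log p\<close> and \<open>b - log (1 - p)\<close> equal \<open>log S\<close>, so their
  average does too.\<close>

lemma gibbs_binary_eq:
  fixes a b :: real
  defines "p \<equiv> 2 powr a / (2 powr a + 2 powr b)"
  shows "0 \<le> p" "p \<le> 1"
    "p * a + (1 - p) * b + binary_entropy p = log 2 (2 powr a + 2 powr b)"
proof -
  define S where "S = (2::real) powr a + 2 powr b"
  have S: "S > 0" by (simp add: S_def add_pos_pos)
  show "0 \<le> p" "p \<le> 1" using S[unfolded S_def] by (auto simp: p_def divide_simps)
  have q: "1 - p = 2 powr b / S" using S by (simp add: p_def S_def[symmetric] field_simps)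
  have p: "p = 2 powr a / S" by (simp add: p_def S_def)
  have l: "log 2 p = a - log 2 S" "log 2 (1 - p) = b - log 2 S"
    unfolding q unfolding p using S by (auto simp: log_divide)
  show "p * a + (1 - p) * b + binary_entropy p = log 2 (2 powr a + 2 powr b)"
    unfolding binary_entropy_def l S_def[symmetric] by (simp add: algebra_simps)
qed

lemma binary_entropy_le:
  assumes "0 \<le> t" "t \<le> 1"
  shows "binary_entropy t \<le> 1"
  using gibbs_binary[OF assms, of 0 0] by simp

text \<open>The expression is the modulus of continuity that \<open>uniformly_continuous\<close>
  produces at distance \<open>t\<close>. The limit from the right says nothing about
  \<open>t = 0\<close>, where the expression vanishes outright.\<close>

lemma binary_entropy_small:
  fixes M :: real
  assumes d: "\<delta> > 0"
  obtains r where "0 < r" "\<And>t. 0 \<le> t \<Longrightarrow> t < r \<Longrightarrow> t * M + binary_entropy t < \<delta>"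
proof -
  have "((\<lambda>t. t * M + binary_entropy t) \<longlongrightarrow> 0) (at_right 0)"
    unfolding binary_entropy_def log_def by real_asymp
  then have "\<forall>\<^sub>F t in at_right 0. t * M + binary_entropy t < \<delta>"
    by (rule order_tendstoD) (use d in simp)
  then obtain r where "r > 0" "\<And>t. 0 < t \<Longrightarrow> t < r \<Longrightarrow> t * M + binary_entropy t < \<delta>"
    unfolding eventually_at_right_field by auto
  then show thesis
    using d by (intro that[of r]) (metis add_0 binary_entropy_0 less_eq_real_def mult_zero_left)+
qed

section \<open>Total variation and compactness of the simplex\<close>

lemma tv_dist_superset:
  assumes "finite X" "P \<in> dists X" "Q \<in> dists X"
  shows "tv_dist P Q = (\<Sum>x\<in>X. \<bar>pmf P x - pmf Q x\<bar>) / 2"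
proof -
  have "(\<Sum>x\<in>set_pmf P \<union> set_pmf Q. \<bar>pmf P x - pmf Q x\<bar>) = (\<Sum>x\<in>X. \<bar>pmf P x - pmf Q x\<bar>)"
    by (rule sum.mono_neutral_left) (use assms in \<open>auto simp: dists_def set_pmf_iff\<close>)
  then show ?thesis by (simp add: tv_dist_def)
qed

lemma tv_dist_nonneg: "0 \<le> tv_dist P Q"
  by (simp add: tv_dist_def sum_nonneg)

text \<open>The pointwise minimum of \<open>P\<close> and \<open>Q\<close> has mass
  \<open>1 - tv_dist P Q\<close>, because \<open>min a b = (a + b - |a - b|) / 2\<close>.
  \<open>R\<close> is this minimum normalised, and \<open>P'\<close>, \<open>Q'\<close> are the
  normalised excesses.\<close>

lemma tv_dist_common_part:
  assumes fin: "finite X" and PQ: "P \<in> dists X" "Q \<in> dists X" and s: "tv_dist P Q < 1"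
  obtains R P' Q' where "R \<in> dists X" "P' \<in> dists X" "Q' \<in> dists X"
    "P = mix_pmf (1 - tv_dist P Q) R P'" "Q = mix_pmf (1 - tv_dist P Q) R Q'"
proof -
  define s where "s = tv_dist P Q"
  have s0: "0 \<le> s" "s < 1" using s by (simp_all add: s_def tv_dist_nonneg)
  have "(\<Sum>x\<in>X. min (pmf P x) (pmf Q x)) = (\<Sum>x\<in>X. (pmf P x + pmf Q x - \<bar>pmf P x - pmf Q x\<bar>) / 2)"
    by (intro sum.cong) auto
  also have "\<dots> = 1 - s"
    using sum_pmf_dists[OF fin PQ(1)] sum_pmf_dists[OF fin PQ(2)]
    by (simp add: s_def tv_dist_superset[OF fin PQ] sum_divide_distrib[symmetric] sum_subtractf sum.distrib field_simps)
  finally have m: "(\<Sum>x\<in>X. min (pmf P x) (pmf Q x) / (1 - s)) = 1"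
    using s0 by (simp add: sum_divide_distrib[symmetric])
  obtain R where R: "R \<in> dists X" "\<And>x. x \<in> X \<Longrightarrow> pmf R x = min (pmf P x) (pmf Q x) / (1 - s)"
    using exists_pmf_finite[OF fin _ m] s0 by auto
  show thesis
  \<comment> \<open>At distance zero there is no excess to normalise; then \<open>P = Q\<close> and
    all three distributions may be \<open>P\<close>.\<close>
  proof (cases "s = 0")
    case True
    then have "(\<Sum>x\<in>X. \<bar>pmf P x - pmf Q x\<bar>) = 0"
      using tv_dist_superset[OF fin PQ] by (simp add: s_def)
    then have "\<forall>x\<in>X. pmf P x = pmf Q x"
      using fin by (subst (asm) sum_nonneg_eq_0_iff) auto
    then have "P = Q"
      using PQ by (intro pmf_eqI) (metis (no_types, lifting) dists_def mem_Collect_eq set_pmf_iff subsetD)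
    then show ?thesis using True PQ
      by (intro that[of P P P]) (simp_all add: s_def)
  next
    case False
    obtain P' where "P' \<in> dists X" "P = mix_pmf (1 - s) R P'"
      by (rule mix_pmf_complement[OF fin R(1) PQ(1), of "1 - s"]) (use s0 False R(2) in auto)
    moreover obtain Q' where "Q' \<in> dists X" "Q = mix_pmf (1 - s) R Q'"
      by (rule mix_pmf_complement[OF fin R(1) PQ(2), of "1 - s"]) (use s0 False R(2) in auto)
    ultimately show ?thesis using R(1) that unfolding s_def by blast
  qed
qed

text \<open>Coordinatewise Bolzano-Weierstrass on \<open>[0,1]\<close>. As \<open>X\<close> is
  finite, no mass escapes and the limit coordinates again sum to 1.\<close>

lemma dists_convergent_subsequence:
  fixes P :: "nat \<Rightarrow> 'a pmf"
  assumes fin: "finite X" and P: "\<And>n. P n \<in> dists X"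
  obtains r R where "strict_mono r" "R \<in> dists X" "(\<lambda>n. tv_dist (P (r n)) R) \<longlonglongrightarrow> 0"
proof -
  have "\<forall>d\<subseteq>X. \<exists>l::'a \<Rightarrow> real. \<exists>r::nat \<Rightarrow> nat. strict_mono r \<and>
      (\<forall>e>0. eventually (\<lambda>n. \<forall>i\<in>d. dist (pmf (P (r n)) i) (l i) < e) sequentially)"
    by (rule compact_lemma_general[where proj = "\<lambda>x. x" and unproj = "\<lambda>x. x" and f = "\<lambda>n. pmf (P n)"])
      (use fin in \<open>auto intro!: boundedI[where B = 1] simp: pmf_le_1\<close>)
  then obtain l :: "'a \<Rightarrow> real" and r :: "nat \<Rightarrow> nat" where r: "strict_mono r"
    and ev: "\<And>e. e > 0 \<Longrightarrow> eventually (\<lambda>n. \<forall>i\<in>X. dist (pmf (P (r n)) i) (l i) < e) sequentially"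
    by blast
  have lim: "(\<lambda>n. pmf (P (r n)) i) \<longlonglongrightarrow> l i" if "i \<in> X" for i
    unfolding tendsto_iff
  proof (intro allI impI)
    fix e :: real assume "e > 0"
    show "\<forall>\<^sub>F n in sequentially. dist (pmf (P (r n)) i) (l i) < e"
      by (rule eventually_mono[OF ev[OF \<open>e > 0\<close>]]) (use that in auto)
  qed
  have nn: "0 \<le> l i" if "i \<in> X" for i
    by (rule tendsto_lowerbound[OF lim[OF that]]) auto
  have "(\<lambda>n. \<Sum>i\<in>X. pmf (P (r n)) i) \<longlonglongrightarrow> (\<Sum>i\<in>X. l i)"
    by (intro tendsto_sum lim)
  then have one: "(\<Sum>i\<in>X. l i) = 1"
    by (simp add: sum_pmf_dists[OF fin P] LIMSEQ_const_iff)
  obtain R where R: "R \<in> dists X" "\<And>x. x \<in> X \<Longrightarrow> pmf R x = l x"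
    using exists_pmf_finite[OF fin nn one] by blast
  have "(\<lambda>n. (\<Sum>x\<in>X. \<bar>pmf (P (r n)) x - l x\<bar>) / 2) \<longlonglongrightarrow> (\<Sum>x\<in>X. \<bar>l x - l x\<bar>) / 2"
    by (intro tendsto_intros lim) simp_all
  then have "(\<lambda>n. tv_dist (P (r n)) R) \<longlonglongrightarrow> 0"
    using R(2) by (simp add: tv_dist_superset[OF fin P R(1)] cong: sum.cong)
  with r R(1) show thesis by (rule that)
qed

section \<open>Graphs and isomorphisms\<close>

lemma pair_graph_iff:
  "pair_graph G \<longleftrightarrow> finite (pverts G) \<and> parcs G \<subseteq> pverts G \<times> pverts G \<and> sym (parcs G) \<and> irrefl (parcs G)"
  (is "_ \<longleftrightarrow> ?R")
proof
  assume "pair_graph G"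
  then interpret pair_graph G .
  show ?R
    using pair_finite_verts arc_fst_in_verts arc_snd_in_verts pair_sym_arcs pair_no_loops
    by (fastforce simp: symmetric_def irrefl_def)
next
  assume R: ?R
  then have fin: "finite (parcs G)" by (meson finite_SigmaI finite_subset)
  show "pair_graph G"
    by unfold_locales (use R fin in \<open>auto simp: symmetric_def irrefl_def\<close>)
qed

lemma pair_graph_finite: "pair_graph G \<Longrightarrow> finite (pverts G)"
  by (simp add: pair_graph_iff)

lemma pair_graph_finite_set_pmf: "pair_graph G \<Longrightarrow> P \<in> dists (pverts G) \<Longrightarrow> finite (set_pmf P)"
  by (auto simp: pair_graph_iff dists_def intro: finite_subset)

lemma pair_graph_sum: "pair_graph G \<Longrightarrow> pair_graph H \<Longrightarrow> pair_graph (G \<squnion>\<^sub>G H)"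
  by (auto simp: pair_graph_iff disjoint_sum_def sym_def irrefl_def)

lemma pair_graph_product: "pair_graph G \<Longrightarrow> pair_graph H \<Longrightarrow> pair_graph (G \<boxtimes> H)"
  by (auto simp: pair_graph_iff strong_product_def sym_def irrefl_def)

lemma pair_graph_K1: "pair_graph K1"
  by (auto simp: pair_graph_iff K1_def sym_def irrefl_def)

lemma pair_graph_induced: "pair_graph G \<Longrightarrow> pair_graph (induced_subgraph_on G S)"
  by (auto simp: pair_graph_iff induced_subgraph_on_def sym_def irrefl_def)

lemma finite_strings: "finite X \<Longrightarrow> finite (strings n X)"
  using finite_lists_length_eq[of X n] by (simp add: strings_def conj_commute)

lemma pair_graph_power: "pair_graph G \<Longrightarrow> pair_graph (strong_power G n)"
  by (auto simp: pair_graph_iff strong_power_def sym_def irrefl_def finite_strings)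

lemma pverts_simps [simp]:
  "pverts (G \<squnion>\<^sub>G H) = pverts G <+> pverts H"
  "pverts (G \<boxtimes> H) = pverts G \<times> pverts H"
  "pverts K1 = {0}"
  "pverts (induced_subgraph_on G S) = pverts G \<inter> S"
  "pverts (strong_power G n) = strings n (pverts G)"
  "pverts (graph_compl G) = pverts G"
  by (simp_all add: disjoint_sum_def strong_product_def K1_def induced_subgraph_on_def
      strong_power_def graph_compl_def)

lemma graph_iso_comp: "graph_iso \<phi> G H \<Longrightarrow> graph_iso \<psi> H K \<Longrightarrow> graph_iso (\<psi> \<circ> \<phi>) G K"
  by (auto simp: graph_iso_def bij_betw_trans bij_betwE)

lemma graph_iso_inv:
  assumes "graph_iso \<phi> G H"
  shows "graph_iso (inv_into (pverts G) \<phi>) H G"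
  unfolding graph_iso_def
proof (intro conjI ballI)
  have b: "bij_betw \<phi> (pverts G) (pverts H)" using assms by (simp add: graph_iso_def)
  then show "bij_betw (inv_into (pverts G) \<phi>) (pverts H) (pverts G)"
    by (rule bij_betw_inv_into)
  fix u v assume uv: "u \<in> pverts H" "v \<in> pverts H"
  let ?i = "inv_into (pverts G) \<phi>"
  have "?i u \<in> pverts G" "?i v \<in> pverts G" "\<phi> (?i u) = u" "\<phi> (?i v) = v"
    using b uv by (auto simp: bij_betw_def inv_into_into f_inv_into_f)
  then show "(u, v) \<in> parcs H \<longleftrightarrow> (?i u, ?i v) \<in> parcs G"
    using assms by (auto simp: graph_iso_def)
qed

lemma graph_iso_bij: "graph_iso \<phi> G H \<Longrightarrow> bij_betw \<phi> (pverts G) (pverts H)"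
  by (simp add: graph_iso_def)

lemma graph_iso_image: "graph_iso \<phi> G H \<Longrightarrow> \<phi> ` pverts G = pverts H"
  by (simp add: graph_iso_def bij_betw_def)

lemma graph_iso_inj: "graph_iso \<phi> G H \<Longrightarrow> inj_on \<phi> (pverts G)"
  by (simp add: graph_iso_def bij_betw_def)

lemma graph_iso_dists: "graph_iso \<phi> G H \<Longrightarrow> P \<in> dists (pverts G) \<Longrightarrow> map_pmf \<phi> P \<in> dists (pverts H)"
  by (rule map_pmf_dists) (simp_all, metis graph_iso_image order_refl)

lemma map_pmf_inv_into:
  assumes "inj_on \<phi> X" "P \<in> dists X"
  shows "map_pmf (inv_into X \<phi>) (map_pmf \<phi> P) = P"
  unfolding map_pmf_comp using assms by (intro map_pmf_idI) (auto simp: dists_def)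

lemma pgclass_iso:
  assumes iso: "graph_iso \<phi> G H" and P: "P \<in> dists (pverts G)"
  shows "pgclass H (map_pmf \<phi> P) = pgclass G P"
proof -
  \<comment> \<open>Stated for fresh vertex types so that it applies both to the isomorphism and to
    its inverse.\<close>
  have sub: "pgclass H (map_pmf \<phi> P) \<subseteq> pgclass G P" if "graph_iso \<phi> G H"
    for \<phi> P and G :: "'c pair_pre_digraph" and H :: "'d pair_pre_digraph"
    unfolding pgclass_def using graph_iso_comp[OF that]
    by (fastforce simp: map_pmf_comp comp_def)
  have "pgclass G (map_pmf (inv_into (pverts G) \<phi>) (map_pmf \<phi> P)) \<subseteq> pgclass H (map_pmf \<phi> P)"
    by (rule sub[OF graph_iso_inv[OF iso]])
  then show ?thesis
    using sub[OF iso, of P] by (simp add: map_pmf_inv_into[OF graph_iso_inj[OF iso] P])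
qed

lemma gclass_iso:
  assumes iso: "graph_iso \<phi> G H"
  shows "gclass H = gclass G"
proof -
  have sub: "gclass H \<subseteq> gclass G" if "graph_iso \<phi> G H"
    for \<phi> and G :: "'c pair_pre_digraph" and H :: "'d pair_pre_digraph"
    unfolding gclass_def using graph_iso_comp[OF that] by blast
  show ?thesis using sub[OF iso] sub[OF graph_iso_inv[OF iso]] by blast
qed

text \<open>The hypotheses on \<open>F\<close> quantify over graphs on natural numbers only. Through
  these copies they reach sums, products, powers and induced subgraphs.\<close>

lemma exists_nat_copy:
  fixes G :: "'a pair_pre_digraph"
  assumes "pair_graph G"
  obtains G' :: "nat pair_pre_digraph" and \<phi> where "pair_graph G'" "graph_iso \<phi> G G'"
proof -
  obtain \<phi> :: "'a \<Rightarrow> nat" where inj: "inj_on \<phi> (pverts G)"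
    using finite_imp_inj_to_nat_seg[OF pair_graph_finite[OF assms]] by blast
  let ?G = "\<lparr>pverts = \<phi> ` pverts G, parcs = map_prod \<phi> \<phi> ` parcs G\<rparr>"
  have sub: "parcs G \<subseteq> pverts G \<times> pverts G" using assms by (simp add: pair_graph_iff)
  have "graph_iso \<phi> G ?G"
    unfolding graph_iso_def
  proof (intro conjI ballI)
    fix u v assume "u \<in> pverts G" "v \<in> pverts G"
    then show "(u, v) \<in> parcs G \<longleftrightarrow> (\<phi> u, \<phi> v) \<in> parcs ?G"
      using inj_on_image_mem_iff[OF map_prod_inj_on[OF inj inj] _ sub, of "(u, v)"] by simp
  qed (simp add: inj bij_betw_def)
  moreover have "pair_graph ?G"
    unfolding pair_graph_iff
  proof (intro conjI)
    show "sym (parcs ?G)" using assms by (auto simp: pair_graph_iff sym_def)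
    show "irrefl (parcs ?G)"
      using assms inj sub by (auto simp: pair_graph_iff irrefl_def inj_on_def)
  qed (use assms sub in \<open>auto simp: pair_graph_iff\<close>)
  ultimately show thesis by (intro that)
qed

section \<open>Isomorphisms between composite graphs\<close>

lemma graph_iso_product:
  assumes "graph_iso \<phi> G G'" "graph_iso \<psi> H H'"
  shows "graph_iso (map_prod \<phi> \<psi>) (G \<boxtimes> H) (G' \<boxtimes> H')"
  unfolding graph_iso_def
proof (intro conjI ballI)
  note b = graph_iso_bij[OF assms(1)] graph_iso_bij[OF assms(2)]
  then show "bij_betw (map_prod \<phi> \<psi>) (pverts (G \<boxtimes> H)) (pverts (G' \<boxtimes> H'))"
    by (simp add: bij_betw_map_prod)
  fix u v assume uv: "u \<in> pverts (G \<boxtimes> H)" "v \<in> pverts (G \<boxtimes> H)"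
  obtain g h g' h' where e: "u = (g, h)" "v = (g', h')" by (cases u, cases v)
  have m: "g \<in> pverts G" "g' \<in> pverts G" "h \<in> pverts H" "h' \<in> pverts H"
    using uv by (auto simp: e)
  have "\<phi> g = \<phi> g' \<longleftrightarrow> g = g'" "\<psi> h = \<psi> h' \<longleftrightarrow> h = h'"
    "(\<phi> g, \<phi> g') \<in> parcs G' \<longleftrightarrow> (g, g') \<in> parcs G"
    "(\<psi> h, \<psi> h') \<in> parcs H' \<longleftrightarrow> (h, h') \<in> parcs H"
    "\<phi> g \<in> pverts G'" "\<phi> g' \<in> pverts G'" "\<psi> h \<in> pverts H'" "\<psi> h' \<in> pverts H'"
    using assms m b by (auto simp: graph_iso_def bij_betw_def inj_on_eq_iff)
  then show "(u, v) \<in> parcs (G \<boxtimes> H) \<longleftrightarrow> (map_prod \<phi> \<psi> u, map_prod \<phi> \<psi> v) \<in> parcs (G' \<boxtimes> H')"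
    using m by (simp add: e strong_product_def)
qed

lemma disjoint_sum_arcs:
  "(Inl a, Inl b) \<in> parcs (G \<squnion>\<^sub>G H) \<longleftrightarrow> (a, b) \<in> parcs G"
  "(Inr c, Inr d) \<in> parcs (G \<squnion>\<^sub>G H) \<longleftrightarrow> (c, d) \<in> parcs H"
  "(Inl a, Inr d) \<notin> parcs (G \<squnion>\<^sub>G H)"
  "(Inr c, Inl b) \<notin> parcs (G \<squnion>\<^sub>G H)"
  by (auto simp: disjoint_sum_def)

lemma graph_iso_sum:
  assumes "graph_iso \<phi> G G'" "graph_iso \<psi> H H'"
  shows "graph_iso (map_sum \<phi> \<psi>) (G \<squnion>\<^sub>G H) (G' \<squnion>\<^sub>G H')"
  unfolding graph_iso_def
proof (intro conjI ballI)
  have "inj_on (map_sum \<phi> \<psi>) (pverts G <+> pverts H)"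
    using graph_iso_inj[OF assms(1)] graph_iso_inj[OF assms(2)]
    by (intro inj_onI) (auto elim!: PlusE dest: inj_onD)
  moreover have "map_sum \<phi> \<psi> ` (pverts G <+> pverts H) = pverts G' <+> pverts H'"
    by (simp add: Plus_def image_Un image_image flip: graph_iso_image[OF assms(1)] graph_iso_image[OF assms(2)])
  ultimately show "bij_betw (map_sum \<phi> \<psi>) (pverts (G \<squnion>\<^sub>G H)) (pverts (G' \<squnion>\<^sub>G H'))"
    by (simp add: bij_betw_def)
  fix u v assume "u \<in> pverts (G \<squnion>\<^sub>G H)" "v \<in> pverts (G \<squnion>\<^sub>G H)"
  then have "u \<in> pverts G <+> pverts H" "v \<in> pverts G <+> pverts H" by simp_all
  moreover have "(\<phi> a, \<phi> b) \<in> parcs G' \<longleftrightarrow> (a, b) \<in> parcs G"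
    if "a \<in> pverts G" "b \<in> pverts G" for a b
    using assms that unfolding graph_iso_def by blast
  moreover have "(\<psi> c, \<psi> d) \<in> parcs H' \<longleftrightarrow> (c, d) \<in> parcs H"
    if "c \<in> pverts H" "d \<in> pverts H" for c d
    using assms that unfolding graph_iso_def by blast
  ultimately show "(u, v) \<in> parcs (G \<squnion>\<^sub>G H) \<longleftrightarrow> (map_sum \<phi> \<psi> u, map_sum \<phi> \<psi> v) \<in> parcs (G' \<squnion>\<^sub>G H')"
    by - (elim PlusE, simp_all add: disjoint_sum_arcs)
qed

lemma graph_iso_compl_hom:
  assumes "graph_iso \<phi> G H"
  shows "graph_hom \<phi> (graph_compl G) (graph_compl H)"
proof -
  have "\<phi> u \<noteq> \<phi> v" if "u \<in> pverts G" "v \<in> pverts G" "u \<noteq> v" for u v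
    using graph_iso_inj[OF assms] that by (auto simp: inj_on_def)
  then show ?thesis
    using assms graph_iso_image[OF assms]
    by (auto simp: graph_hom_def graph_compl_def graph_iso_def)
qed

lemma graph_hom_comp: "graph_hom \<phi> G H \<Longrightarrow> graph_hom \<psi> H K \<Longrightarrow> graph_hom (\<psi> \<circ> \<phi>) G K"
  by (auto simp: graph_hom_def)

lemma graph_hom_dists: "graph_hom \<phi> G H \<Longrightarrow> P \<in> dists (pverts G) \<Longrightarrow> map_pmf \<phi> P \<in> dists (pverts H)"
  by (rule map_pmf_dists) (auto simp: graph_hom_def)

text \<open>\<open>K1 \<squnion>\<^sub>G K1\<close> has two vertices and no edge, so multiplying by
  it yields two copies of \<open>G\<close> with no edge between them. A disjoint union thereby
  becomes accessible to (P2).\<close>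

lemma graph_iso_double:
  "graph_iso (case_sum (\<lambda>x. (x, Inl 0)) (\<lambda>x. (x, Inr 0))) (G \<squnion>\<^sub>G G) (G \<boxtimes> (K1 \<squnion>\<^sub>G K1))"
  if "pair_graph G"
  unfolding graph_iso_def
proof (intro conjI ballI)
  let ?f = "case_sum (\<lambda>x. (x, Inl 0)) (\<lambda>x. (x, Inr 0)) :: 'a + 'a \<Rightarrow> 'a \<times> (nat + nat)"
  show "bij_betw ?f (pverts (G \<squnion>\<^sub>G G)) (pverts (G \<boxtimes> (K1 \<squnion>\<^sub>G K1)))"
    unfolding bij_betw_def
  proof
    show "?f ` pverts (G \<squnion>\<^sub>G G) = pverts (G \<boxtimes> (K1 \<squnion>\<^sub>G K1))"
      by (simp add: Plus_def image_Un image_image) auto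
  qed (auto simp: inj_on_def)
  fix u v assume "u \<in> pverts (G \<squnion>\<^sub>G G)" "v \<in> pverts (G \<squnion>\<^sub>G G)"
  then show "(u, v) \<in> parcs (G \<squnion>\<^sub>G G) \<longleftrightarrow> (?f u, ?f v) \<in> parcs (G \<boxtimes> (K1 \<squnion>\<^sub>G K1))"
    using that by (auto simp: disjoint_sum_def strong_product_def K1_def pair_graph_iff irrefl_def)
qed

lemma graph_iso_singleton:
  assumes "pair_graph G" "pverts G = {v}" 
  shows "graph_iso (\<lambda>_. v) K1 G"
  using assms by (auto simp: graph_iso_def K1_def bij_betw_def pair_graph_iff irrefl_def)

lemma graph_iso_power_Suc:
  "graph_iso (\<lambda>(x, xs). x # xs) (G \<boxtimes> strong_power G n) (strong_power G (Suc n))"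
  unfolding graph_iso_def
proof (intro conjI ballI)
  show "bij_betw (\<lambda>(x, xs). x # xs) (pverts (G \<boxtimes> strong_power G n)) (pverts (strong_power G (Suc n)))"
    unfolding bij_betw_def
    by (auto simp: inj_on_def strings_def image_iff length_Suc_conv)
  fix u v assume uv: "u \<in> pverts (G \<boxtimes> strong_power G n)" "v \<in> pverts (G \<boxtimes> strong_power G n)"
  obtain x xs y ys where e: "u = (x, xs)" "v = (y, ys)" by (cases u, cases v)
  have "(xs = ys \<or> (xs, ys) \<in> parcs (strong_power G n)) \<longleftrightarrow>
      (\<forall>i<n. xs ! i = ys ! i \<or> (xs ! i, ys ! i) \<in> parcs G)"
    using uv by (auto simp: e strong_power_def)
  then show "(u, v) \<in> parcs (G \<boxtimes> strong_power G n) \<longleftrightarrow>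
      ((\<lambda>(x, xs). x # xs) u, (\<lambda>(x, xs). x # xs) v) \<in> parcs (strong_power G (Suc n))"
    using uv unfolding e
    by (simp add: strong_product_def) (auto simp: strong_power_def strings_def All_less_Suc2)
qed

section \<open>Transfer of (P1)-(P4) to arbitrary vertex types\<close>

locale probabilistic_refinement =
  fixes F :: "prob_graph_class \<Rightarrow> real"
  assumes nat_P1: "\<And>(G :: nat pair_pre_digraph) P Q t.
      \<lbrakk>pair_graph G; pverts G \<noteq> {}; P \<in> dists (pverts G); Q \<in> dists (pverts G); 0 \<le> t; t \<le> 1\<rbrakk> \<Longrightarrow>
      t * F (pgclass G P) + (1 - t) * F (pgclass G Q) \<le> F (pgclass G (mix_pmf t P Q))"
    and nat_P2: "\<And>(G :: nat pair_pre_digraph) (H :: nat pair_pre_digraph) P.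
      \<lbrakk>pair_graph G; pair_graph H; pverts G \<noteq> {}; pverts H \<noteq> {};
       P \<in> dists (pverts G \<times> pverts H)\<rbrakk> \<Longrightarrow>
      F (pgclass (G \<boxtimes> H) P)
        \<le> F (pgclass G (map_pmf fst P)) + F (pgclass H (map_pmf snd P)) \<and>
      F (pgclass G (map_pmf fst P)) + F (pgclass H (map_pmf snd P))
        \<le> F (pgclass (G \<boxtimes> H) P) + shannon_entropy (map_pmf fst P)
            + shannon_entropy (map_pmf snd P) - shannon_entropy P"
    and nat_P3: "\<And>(G :: nat pair_pre_digraph) (H :: nat pair_pre_digraph) P Q p.
      \<lbrakk>pair_graph G; pair_graph H; pverts G \<noteq> {}; pverts H \<noteq> {};
       P \<in> dists (pverts G); Q \<in> dists (pverts H); 0 \<le> p; p \<le> 1\<rbrakk> \<Longrightarrow>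
      F (pgclass (G \<squnion>\<^sub>G H) (oplus_pmf p P Q))
        = p * F (pgclass G P) + (1 - p) * F (pgclass H Q) + binary_entropy p"
    and nat_P4: "\<And>(G :: nat pair_pre_digraph) (H :: nat pair_pre_digraph) \<phi> P.
      \<lbrakk>pair_graph G; pair_graph H; graph_hom \<phi> (graph_compl H) (graph_compl G);
       P \<in> dists (pverts H)\<rbrakk> \<Longrightarrow>
      F (pgclass H P) \<le> F (pgclass G (map_pmf \<phi> P))"
begin

text \<open>Polymorphic in the vertex type, since \<open>pgclass\<close> always lands in classes of
  graphs on natural numbers. The four lemmas after \<open>Fv_iso\<close> restate the hypotheses for
  \<open>Fv\<close>; \<open>dists_nonempty\<close> supplies the nonemptiness that (P1)-(P3) ask
  for.\<close>

definition Fv :: "'a pair_pre_digraph \<Rightarrow> 'a pmf \<Rightarrow> real" where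
  "Fv G P = F (pgclass G P)"

lemma Fv_iso: "graph_iso \<phi> G H \<Longrightarrow> P \<in> dists (pverts G) \<Longrightarrow> Fv H (map_pmf \<phi> P) = Fv G P"
  by (simp add: Fv_def pgclass_iso)

lemma concave:
  assumes G: "pair_graph G" and PQ: "P \<in> dists (pverts G)" "Q \<in> dists (pverts G)"
    and t: "0 \<le> t" "t \<le> 1"
  shows "t * Fv G P + (1 - t) * Fv G Q \<le> Fv G (mix_pmf t P Q)"
proof -
  obtain G' :: "nat pair_pre_digraph" and \<phi> where G': "pair_graph G'" and iso: "graph_iso \<phi> G G'"
    using exists_nat_copy[OF G] by blast
  note d = graph_iso_dists[OF iso PQ(1)] graph_iso_dists[OF iso PQ(2)]
  have "t * Fv G' (map_pmf \<phi> P) + (1 - t) * Fv G' (map_pmf \<phi> Q)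
      \<le> Fv G' (map_pmf \<phi> (mix_pmf t P Q))"
    using nat_P1[OF G' dists_nonempty[OF d(1)] d t] by (simp add: Fv_def map_pmf_mix_pmf)
  then show ?thesis by (simp add: Fv_iso[OF iso] PQ mix_pmf_dists)
qed

lemma
  assumes G: "pair_graph G" and H: "pair_graph H" and P: "P \<in> dists (pverts G \<times> pverts H)"
  shows product_le: "Fv (G \<boxtimes> H) P \<le> Fv G (map_pmf fst P) + Fv H (map_pmf snd P)" (is ?A)
    and product_ge: "Fv G (map_pmf fst P) + Fv H (map_pmf snd P)
      \<le> Fv (G \<boxtimes> H) P + shannon_entropy (map_pmf fst P) + shannon_entropy (map_pmf snd P)
        - shannon_entropy P" (is ?B)
proof -
  obtain G' :: "nat pair_pre_digraph" and \<phi> where G': "pair_graph G'" and isoG: "graph_iso \<phi> G G'"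
    using exists_nat_copy[OF G] by blast
  obtain H' :: "nat pair_pre_digraph" and \<psi> where H': "pair_graph H'" and isoH: "graph_iso \<psi> H H'"
    using exists_nat_copy[OF H] by blast
  note iso = graph_iso_product[OF isoG isoH]
  have P': "P \<in> dists (pverts (G \<boxtimes> H))" using P by simp
  have d: "map_pmf fst P \<in> dists (pverts G)" "map_pmf snd P \<in> dists (pverts H)"
    using P by (auto simp: dists_def)
  have d': "map_pmf \<phi> (map_pmf fst P) \<in> dists (pverts G')" "map_pmf \<psi> (map_pmf snd P) \<in> dists (pverts H')"
    "map_pmf (map_prod \<phi> \<psi>) P \<in> dists (pverts G' \<times> pverts H')"
    using graph_iso_dists[OF isoG d(1)] graph_iso_dists[OF isoH d(2)] graph_iso_dists[OF iso P']
    by auto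
  have m: "map_pmf fst (map_pmf (map_prod \<phi> \<psi>) P) = map_pmf \<phi> (map_pmf fst P)"
    "map_pmf snd (map_pmf (map_prod \<phi> \<psi>) P) = map_pmf \<psi> (map_pmf snd P)"
    by (simp_all add: map_pmf_comp)
  \<comment> \<open>Relabelling is injective on the supports, so the entropy correction in (P2) is
    the same for the copies.\<close>
  have e: "shannon_entropy (map_pmf \<phi> (map_pmf fst P)) = shannon_entropy (map_pmf fst P)"
    "shannon_entropy (map_pmf \<psi> (map_pmf snd P)) = shannon_entropy (map_pmf snd P)"
    "shannon_entropy (map_pmf (map_prod \<phi> \<psi>) P) = shannon_entropy P"
    using graph_iso_inj[OF isoG] graph_iso_inj[OF isoH] graph_iso_inj[OF iso] d P'
      pair_graph_finite_set_pmf[OF G d(1)] pair_graph_finite_set_pmf[OF H d(2)]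
      pair_graph_finite_set_pmf[OF pair_graph_product[OF G H] P']
    unfolding dists_def by (auto intro!: shannon_entropy_map_inj intro: inj_on_subset simp del: set_map_pmf)
  have *: "Fv G' (map_pmf \<phi> (map_pmf fst P)) = Fv G (map_pmf fst P)"
    "Fv H' (map_pmf \<psi> (map_pmf snd P)) = Fv H (map_pmf snd P)"
    "Fv (G' \<boxtimes> H') (map_pmf (map_prod \<phi> \<psi>) P) = Fv (G \<boxtimes> H) P"
    using Fv_iso[OF isoG d(1)] Fv_iso[OF isoH d(2)] Fv_iso[OF iso P'] by auto
  note P2 = nat_P2[OF G' H' dists_nonempty[OF d'(1)] dists_nonempty[OF d'(2)] d'(3), folded Fv_def,
      unfolded m e *]
  from P2 show ?A ?B by auto
qed

lemma sum_eq:
  assumes G: "pair_graph G" and H: "pair_graph H" and PQ: "P \<in> dists (pverts G)" "Q \<in> dists (pverts H)"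
    and p: "0 \<le> p" "p \<le> 1"
  shows "Fv (G \<squnion>\<^sub>G H) (oplus_pmf p P Q) = p * Fv G P + (1 - p) * Fv H Q + binary_entropy p"
proof -
  obtain G' :: "nat pair_pre_digraph" and \<phi> where G': "pair_graph G'" and isoG: "graph_iso \<phi> G G'"
    using exists_nat_copy[OF G] by blast
  obtain H' :: "nat pair_pre_digraph" and \<psi> where H': "pair_graph H'" and isoH: "graph_iso \<psi> H H'"
    using exists_nat_copy[OF H] by blast
  note iso = graph_iso_sum[OF isoG isoH]
  have o: "oplus_pmf p P Q \<in> dists (pverts (G \<squnion>\<^sub>G H))" using PQ by (simp add: oplus_pmf_dists)
  note d = graph_iso_dists[OF isoG PQ(1)] graph_iso_dists[OF isoH PQ(2)]
  have "Fv (G' \<squnion>\<^sub>G H') (map_pmf (map_sum \<phi> \<psi>) (oplus_pmf p P Q))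
      = p * Fv G' (map_pmf \<phi> P) + (1 - p) * Fv H' (map_pmf \<psi> Q) + binary_entropy p"
    unfolding map_oplus_pmf Fv_def
    by (rule nat_P3[OF G' H' dists_nonempty[OF d(1)] dists_nonempty[OF d(2)] d p])
  then show ?thesis
    by (simp only: Fv_iso[OF iso o] Fv_iso[OF isoG PQ(1)] Fv_iso[OF isoH PQ(2)])
qed

lemma hom_le:
  assumes G: "pair_graph G" and H: "pair_graph H"
    and hom: "graph_hom \<theta> (graph_compl H) (graph_compl G)" and P: "P \<in> dists (pverts H)"
  shows "Fv H P \<le> Fv G (map_pmf \<theta> P)"
proof -
  obtain G' :: "nat pair_pre_digraph" and \<phi> where G': "pair_graph G'" and isoG: "graph_iso \<phi> G G'"
    using exists_nat_copy[OF G] by blast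
  obtain H' :: "nat pair_pre_digraph" and \<psi> where H': "pair_graph H'" and isoH: "graph_iso \<psi> H H'"
    using exists_nat_copy[OF H] by blast
  let ?i = "inv_into (pverts H) \<psi>"
  \<comment> \<open>The given map is conjugated by the relabellings, which preserve non-adjacency of
    distinct vertices and hence are homomorphisms of complements.\<close>
  have hom': "graph_hom (\<phi> \<circ> \<theta> \<circ> ?i) (graph_compl H') (graph_compl G')"
    by (intro graph_hom_comp[OF graph_iso_compl_hom[OF graph_iso_inv[OF isoH]]]
        graph_hom_comp[OF hom graph_iso_compl_hom[OF isoG]])
  have "map_pmf (\<phi> \<circ> \<theta> \<circ> ?i) (map_pmf \<psi> P) = map_pmf \<phi> (map_pmf \<theta> (map_pmf ?i (map_pmf \<psi> P)))"
    by (simp add: map_pmf_comp)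
  also have "\<dots> = map_pmf \<phi> (map_pmf \<theta> P)"
    by (simp only: map_pmf_inv_into[OF graph_iso_inj[OF isoH] P])
  finally have m: "map_pmf (\<phi> \<circ> \<theta> \<circ> ?i) (map_pmf \<psi> P) = map_pmf \<phi> (map_pmf \<theta> P)" .
  have "map_pmf \<theta> P \<in> dists (pverts G)" using graph_hom_dists[OF hom] P by simp
  then show ?thesis
    using nat_P4[OF G' H' hom' graph_iso_dists[OF isoH P]] unfolding m Fv_def[symmetric]
    by (simp only: Fv_iso[OF isoG] Fv_iso[OF isoH P])
qed

end

section \<open>The induced functional\<close>

text \<open>Makes (P3) applicable to every distribution on a disjoint union, as the maximisation in
  \<open>val_sum\<close> requires. The weight \<open>p\<close> is the mass of the left
  summand.\<close>

lemma oplus_pmf_cases: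
  assumes R: "R \<in> dists (X <+> Y)" and ne: "X \<noteq> {}" "Y \<noteq> {}"
  obtains p P Q where "0 \<le> p" "p \<le> 1" "P \<in> dists X" "Q \<in> dists Y" "R = oplus_pmf p P Q"
proof -
  obtain x0 y0 where xy0: "x0 \<in> X" "y0 \<in> Y" using ne by blast
  define p where "p = measure_pmf.prob R (range Inl)"
  have p01: "0 \<le> p" "p \<le> 1" by (simp_all add: p_def)
  obtain R1 R2 where R12: "R = mix_pmf p R1 R2"
    and R1: "p \<noteq> 0 \<Longrightarrow> set_pmf R1 \<subseteq> set_pmf R \<inter> range Inl"
    and R2: "p \<noteq> 1 \<Longrightarrow> set_pmf R2 \<subseteq> set_pmf R - range Inl"
    using mix_pmf_split[of R "range Inl"] unfolding p_def by metis
  \<comment> \<open>If the left summand has no mass, its component is arbitrary and a point mass at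
    \<open>x0\<close> serves; the right summand is handled in the same way at
    \<open>p = 1\<close>.\<close>
  have "\<exists>P\<in>dists X. p \<noteq> 0 \<longrightarrow> map_pmf Inl P = R1"
  proof (cases "p = 0")
    case True
    then show ?thesis using xy0 by - (rule bexI[of _ "return_pmf x0"], auto simp: dists_def)
  next
    case False
    have e: "map_pmf Inl (map_pmf projl R1) = R1"
      unfolding map_pmf_comp using R1[OF False] by (intro map_pmf_idI) auto
    have "map_pmf projl R1 \<in> dists X"
      using R1[OF False] R by (fastforce simp: dists_def)
    with e show ?thesis by blast
  qed
  then obtain P where P: "P \<in> dists X" "p \<noteq> 0 \<Longrightarrow> map_pmf Inl P = R1" by blast
  have "\<exists>Q\<in>dists Y. p \<noteq> 1 \<longrightarrow> map_pmf Inr Q = R2"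
  proof (cases "p = 1")
    case True
    then show ?thesis using xy0 by - (rule bexI[of _ "return_pmf y0"], auto simp: dists_def)
  next
    case False
    have sub: "set_pmf R2 \<subseteq> Inr ` Y"
    proof
      fix z assume "z \<in> set_pmf R2"
      then have "z \<in> X <+> Y" "z \<notin> range Inl" using R2[OF False] R by (auto simp: dists_def)
      then show "z \<in> Inr ` Y" by (elim PlusE) auto
    qed
    then have e: "map_pmf Inr (map_pmf projr R2) = R2"
      unfolding map_pmf_comp by (intro map_pmf_idI) auto
    have "map_pmf projr R2 \<in> dists Y"
      using sub by (fastforce simp: dists_def)
    with e show ?thesis by blast
  qed
  then obtain Q where Q: "Q \<in> dists Y" "p \<noteq> 1 \<Longrightarrow> map_pmf Inr Q = R2" by blast
  have "R = oplus_pmf p P Q"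
    unfolding oplus_pmf_def using P(2) Q(2) R12
    by (cases "p = 0"; cases "p = 1") simp_all
  with p01 P(1) Q(1) show thesis by (rule that)
qed

section \<open>Bounds, almost convexity and continuity of \<open>F\<close>\<close>

context probabilistic_refinement
begin

text \<open>\<open>K1 \<boxtimes> K1\<close> is a copy of \<open>K1\<close> and all entropies
  vanish, so (P2) reads \<open>x \<le> 2x \<le> x\<close>.\<close>

lemma Fv_K1: "Fv K1 (return_pmf 0) = 0"
proof -
  have iso: "graph_iso (\<lambda>_. (0, 0)) K1 (K1 \<boxtimes> K1)"
    by (rule graph_iso_singleton) (auto intro: pair_graph_product pair_graph_K1)
  have "Fv (K1 \<boxtimes> K1) (return_pmf (0, 0)) = Fv K1 (return_pmf 0)"
    using Fv_iso[OF iso, of "return_pmf 0"] by (simp add: dists_def)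
  then show ?thesis
    using product_le[OF pair_graph_K1 pair_graph_K1, of "return_pmf (0, 0)"]
      product_ge[OF pair_graph_K1 pair_graph_K1, of "return_pmf (0, 0)"]
    by (simp add: dists_def)
qed

text \<open>The complement of \<open>K1\<close> has no edges, so every constant map out of it is a
  homomorphism and (P4) compares with \<open>Fv_K1\<close>.\<close>

lemma point_nonneg:
  assumes "pair_graph G" "v \<in> pverts G"
  shows "0 \<le> Fv G (return_pmf v)"
proof -
  have "graph_hom (\<lambda>_. v) (graph_compl K1) (graph_compl G)"
    using assms by (auto simp: graph_hom_def graph_compl_def K1_def)
  from hom_le[OF assms(1) pair_graph_K1 this, of "return_pmf 0"] show ?thesis
    by (simp add: dists_def Fv_K1)
qed

text \<open>A concave function on a simplex is bounded below by its values at the corners. The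
  induction removes one point of the support at a time by conditioning.\<close>

lemma nonneg:
  assumes G: "pair_graph G" and P: "P \<in> dists (pverts G)"
  shows "0 \<le> Fv G P"
  using P
proof (induction "card (set_pmf P)" arbitrary: P rule: less_induct)
  case less
  note fin = pair_graph_finite_set_pmf[OF G less.prems]
  obtain x where x: "x \<in> set_pmf P" using set_pmf_not_empty[of P] by blast
  then have xV: "x \<in> pverts G" using less.prems by (auto simp: dists_def)
  show ?case
  proof (cases "set_pmf P = {x}")
    case True
    then have "P = return_pmf x" by (metis set_pmf_subset_singleton subset_refl)
    then show ?thesis using point_nonneg[OF G xV] by simp
  next
    case False
    then have ne: "set_pmf P \<inter> {x} \<noteq> {}" "set_pmf P \<inter> -{x} \<noteq> {}" using x by auto
    let ?p = "measure_pmf.prob P {x}"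
    have c1: "cond_pmf P {x} = return_pmf x"
      using x by (simp add: set_pmf_subset_singleton[symmetric] ne)
    have c2: "set_pmf (cond_pmf P (-{x})) = set_pmf P - {x}" by (auto simp: ne)
    have d: "return_pmf x \<in> dists (pverts G)" "cond_pmf P (-{x}) \<in> dists (pverts G)"
      using c2 xV less.prems by (auto simp: dists_def)
    have "0 \<le> Fv G (cond_pmf P (-{x}))"
      by (rule less.hyps[OF _ d(2)]) (use fin x c2 in \<open>simp add: card_Diff1_less del: card_Diff_insert\<close>)
    then have "0 \<le> ?p * Fv G (return_pmf x) + (1 - ?p) * Fv G (cond_pmf P (-{x}))"
      using point_nonneg[OF G xV] by simp
    also have "\<dots> \<le> Fv G (mix_pmf ?p (return_pmf x) (cond_pmf P (-{x})))"
      by (rule concave[OF G d]) simp_all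
    also have "mix_pmf ?p (return_pmf x) (cond_pmf P (-{x})) = P"
      using mix_cond_pmf[OF ne] by (simp add: c1)
    finally show ?thesis .
  qed
qed

text \<open>Deleting all edges between \<open>S\<close> and its complement turns \<open>G\<close> into a disjoint union, in which (P3)
  with \<open>p = 1\<close> sees only the part on \<open>S\<close>.\<close>

lemma Fv_induced:
  assumes G: "pair_graph G" and P: "P \<in> dists (pverts G \<inter> S)"
  shows "Fv (induced_subgraph_on G S) P = Fv G P"
proof (rule antisym)
  let ?A = "induced_subgraph_on G S" and ?B = "induced_subgraph_on G (-S)"
  have A: "pair_graph ?A" and B: "pair_graph ?B" using G by (simp_all add: pair_graph_induced)
  have PA: "P \<in> dists (pverts ?A)" using P by simp
  have PG: "P \<in> dists (pverts G)" using P by (auto simp: dists_def)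
  have "graph_hom (\<lambda>x. x) (graph_compl ?A) (graph_compl G)"
    by (auto simp: graph_hom_def graph_compl_def induced_subgraph_on_def)
  from hom_le[OF G A this PA] show "Fv ?A P \<le> Fv G P" by simp
  show "Fv G P \<le> Fv ?A P"
  \<comment> \<open>(P3) needs a distribution on each summand. The point mass at \<open>w\<close>,
    of weight zero, provides the one outside \<open>S\<close>; if \<open>S\<close> contains all
    vertices there is no such \<open>w\<close>, but then the identity maps back.\<close>
  proof (cases "pverts G \<subseteq> S")
    case True
    then have "graph_hom (\<lambda>x. x) (graph_compl G) (graph_compl ?A)"
      by (auto simp: graph_hom_def graph_compl_def induced_subgraph_on_def)
    from hom_le[OF A G this PG] show ?thesis by simp
  next
    case False
    then obtain w where w: "w \<in> pverts G" "w \<notin> S" by blast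
    then have Q: "return_pmf w \<in> dists (pverts ?B)" by (simp add: dists_def)
    let ?\<phi> = "\<lambda>x. if x \<in> S then Inl x else Inr x"
    have "graph_hom ?\<phi> (graph_compl G) (graph_compl (?A \<squnion>\<^sub>G ?B))"
      by (auto simp: graph_hom_def graph_compl_def induced_subgraph_on_def disjoint_sum_def)
    from hom_le[OF pair_graph_sum[OF A B] G this PG]
    have "Fv G P \<le> Fv (?A \<squnion>\<^sub>G ?B) (map_pmf ?\<phi> P)" .
    also have "map_pmf ?\<phi> P = oplus_pmf 1 P (return_pmf w)"
      using P by (auto simp: oplus_pmf_def dists_def intro!: map_pmf_cong)
    also have "Fv (?A \<squnion>\<^sub>G ?B) \<dots> = Fv ?A P"
      by (subst sum_eq[OF A B PA Q]) simp_all
    finally show ?thesis .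
  qed
qed

text \<open>Apply (P2) to the distribution on \<open>G \<boxtimes> (K1 \<squnion> K1)\<close>, a copy of \<open>G \<squnion> G\<close>, that also records which
  of the two components of the mixture was chosen.\<close>

lemma almost_convex:
  assumes G: "pair_graph G" and PQ: "P \<in> dists (pverts G)" "Q \<in> dists (pverts G)"
    and t: "0 \<le> t" "t \<le> 1"
  shows "Fv G (mix_pmf t P Q) \<le> t * Fv G P + (1 - t) * Fv G Q + binary_entropy t"
proof -
  let ?E = "K1 \<squnion>\<^sub>G K1" and ?f = "case_sum (\<lambda>x. (x, Inl 0)) (\<lambda>x. (x, Inr 0)) :: 'a + 'a \<Rightarrow> 'a \<times> (nat + nat)"
  let ?R = "map_pmf ?f (oplus_pmf t P Q)"
  have E: "pair_graph ?E" by (intro pair_graph_sum pair_graph_K1)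
  have o: "oplus_pmf t P Q \<in> dists (pverts (G \<squnion>\<^sub>G G))" using PQ by (simp add: oplus_pmf_dists)
  have R: "?R \<in> dists (pverts G \<times> pverts ?E)"
    using graph_iso_dists[OF graph_iso_double[OF G] o] by simp
  have FR: "Fv (G \<boxtimes> ?E) ?R = t * Fv G P + (1 - t) * Fv G Q + binary_entropy t"
    using Fv_iso[OF graph_iso_double[OF G] o] sum_eq[OF G G PQ t] by simp
  have fst: "map_pmf fst ?R = mix_pmf t P Q"
    by (simp add: oplus_pmf_def map_pmf_mix_pmf map_pmf_comp)
  have snd: "map_pmf snd ?R = oplus_pmf t (return_pmf 0) (return_pmf 0)"
    by (simp add: oplus_pmf_def map_pmf_mix_pmf map_pmf_comp)
  have K: "return_pmf 0 \<in> dists (pverts K1)" by (simp add: dists_def)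
  \<comment> \<open>This equals the entropy of the second marginal, so the two terms cancel in
    (P2).\<close>
  have FE: "Fv ?E (map_pmf snd ?R) = binary_entropy t"
    unfolding snd using sum_eq[OF pair_graph_K1 pair_graph_K1 K K t] by (simp add: Fv_K1)
  have "finite (set_pmf ?R)"
    using pair_graph_finite_set_pmf[OF pair_graph_product[OF G E], of ?R] R by simp
  \<comment> \<open>Forgetting which component was chosen cannot increase entropy; what is left of
    the correction in (P2) is therefore nonpositive.\<close>
  from shannon_entropy_map_le[OF this, of fst]
  have "shannon_entropy (map_pmf fst ?R) \<le> shannon_entropy ?R" .
  moreover have "shannon_entropy (map_pmf snd ?R) = binary_entropy t"
    unfolding snd by (rule shannon_entropy_oplus_points[OF t])
  ultimately show ?thesis
    using product_ge[OF G E R] unfolding FR FE fst by simp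
qed

text \<open>With \<open>m\<close> vertices the uniform distribution \<open>U\<close> is a mixture of
  \<open>P\<close>, with weight \<open>1/m\<close>, and a remainder. By concavity and
  \<open>nonneg\<close> this gives \<open>F(P) \<le> m F(U)\<close>.\<close>

lemma bounded_above:
  assumes G: "pair_graph G"
  obtains M where "0 \<le> M" "\<And>P. P \<in> dists (pverts G) \<Longrightarrow> Fv G P \<le> M"
proof (cases "pverts G = {}")
  case True
  then show ?thesis using that[of 0] dists_nonempty by fastforce
next
  case ne: False
  let ?m = "real (card (pverts G))" and ?U = "pmf_of_set (pverts G)"
  note fin = pair_graph_finite[OF G]
  have m: "?m \<ge> 1" using ne fin by (simp add: Suc_le_eq card_gt_0_iff)
  have U: "?U \<in> dists (pverts G)" using ne fin by (simp add: dists_def)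
  have "Fv G P \<le> ?m * Fv G ?U" if P: "P \<in> dists (pverts G)" for P
  \<comment> \<open>With a single vertex the weight \<open>1/m\<close> is 1 and no remainder
    exists.\<close>
  proof (cases "?m = 1")
    case True
    then obtain v where v: "pverts G = {v}" by (auto simp: card_1_singleton_iff)
    then have "P = return_pmf v" using P by (simp add: dists_def set_pmf_subset_singleton)
    then show ?thesis using True v by (simp add: pmf_of_set_singleton)
  next
    case False
    with m have m1: "?m > 1" by simp
    obtain R where R: "R \<in> dists (pverts G)" "?U = mix_pmf (1 / ?m) P R"
    proof (rule mix_pmf_complement[OF fin P U])
      fix x assume "x \<in> pverts G"
      then show "1 / ?m * pmf P x \<le> pmf ?U x"
        using fin m ne by (auto simp: pmf_of_set divide_right_mono pmf_le_1)
    qed (use m1 in auto)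
    have "1 / ?m * Fv G P + (1 - 1 / ?m) * Fv G R \<le> Fv G ?U"
      unfolding R(2) by (rule concave[OF G P R(1)]) (use m1 in auto)
    moreover have "0 \<le> (1 - 1 / ?m) * Fv G R"
      using m1 nonneg[OF G R(1)] by simp
    ultimately have "1 / ?m * Fv G P \<le> Fv G ?U" by linarith
    then show ?thesis using m1 by (simp add: field_simps)
  qed
  moreover have "0 \<le> ?m * Fv G ?U" using nonneg[OF G U] by simp
  ultimately show ?thesis by (rule that[rotated])
qed

text \<open>\<open>P\<close> and \<open>Q\<close> share a component \<open>R\<close> of weight
  \<open>1 - s\<close>, where \<open>s\<close> is their distance. Almost convexity bounds
  \<open>F(P)\<close> above and concavity bounds \<open>F(Q)\<close> below, both in terms of
  \<open>R\<close>; the gap is at most \<open>sM + h(s)\<close>.\<close>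

lemma uniformly_continuous:
  assumes G: "pair_graph G" and d: "\<delta> > 0"
  obtains r where "0 < r"
    "\<And>P Q. P \<in> dists (pverts G) \<Longrightarrow> Q \<in> dists (pverts G) \<Longrightarrow> tv_dist P Q < r \<Longrightarrow> Fv G P \<le> Fv G Q + \<delta>"
proof -
  obtain M where M: "0 \<le> M" "\<And>P. P \<in> dists (pverts G) \<Longrightarrow> Fv G P \<le> M"
    using bounded_above[OF G] by blast
  obtain r where r: "0 < r" "\<And>t. 0 \<le> t \<Longrightarrow> t < r \<Longrightarrow> t * M + binary_entropy t < \<delta>"
    using binary_entropy_small[OF d] by blast
  show thesis
  \<comment> \<open>The cap at 1 keeps the common part from vanishing.\<close>
  proof (rule that[of "min r 1"])
    fix P Q assume PQ: "P \<in> dists (pverts G)" "Q \<in> dists (pverts G)" and tv: "tv_dist P Q < min r 1"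
    let ?s = "tv_dist P Q"
    have s: "0 \<le> ?s" "?s < 1" "?s < r" using tv by (auto simp: tv_dist_nonneg)
    obtain R P' Q' where R: "R \<in> dists (pverts G)" "P' \<in> dists (pverts G)" "Q' \<in> dists (pverts G)"
      and e: "P = mix_pmf (1 - ?s) R P'" "Q = mix_pmf (1 - ?s) R Q'"
      using tv_dist_common_part[OF pair_graph_finite[OF G] PQ s(2)] by blast
    have "Fv G P \<le> (1 - ?s) * Fv G R + ?s * Fv G P' + binary_entropy ?s"
      using almost_convex[OF G R(1,2), of "1 - ?s", folded e(1)] s
      by (simp add: binary_entropy_def algebra_simps)
    also have "\<dots> \<le> (1 - ?s) * Fv G R + ?s * M + binary_entropy ?s"
      using M(2)[OF R(2)] s by (simp add: mult_left_mono)
    also have "\<dots> \<le> (1 - ?s) * Fv G R + \<delta>" using r(2)[of ?s] s by simp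
    also have "(1 - ?s) * Fv G R \<le> (1 - ?s) * Fv G R + ?s * Fv G Q'"
      using nonneg[OF G R(3)] s by simp
    also have "\<dots> \<le> Fv G Q"
      using concave[OF G R(1,3), of "1 - ?s", folded e(2)] s by simp
    finally show "Fv G P \<le> Fv G Q + \<delta>" by simp
  qed (use r in simp)
qed

lemma attains_maximum:
  assumes G: "pair_graph G" and ne: "pverts G \<noteq> {}"
  obtains P where "P \<in> dists (pverts G)" "\<And>Q. Q \<in> dists (pverts G) \<Longrightarrow> Fv G Q \<le> Fv G P"
proof -
  let ?D = "dists (pverts G)"
  define s where "s = Sup (Fv G ` ?D)"
  obtain M where M: "\<And>P. P \<in> ?D \<Longrightarrow> Fv G P \<le> M" using bounded_above[OF G] by blast
  then have bdd: "bdd_above (Fv G ` ?D)" by (auto simp: bdd_above_def)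
  obtain v where "v \<in> pverts G" using ne by blast
  then have D: "Fv G ` ?D \<noteq> {}" by (auto simp: dists_def intro!: exI[of _ "return_pmf v"])
  have "\<exists>P\<in>?D. s - 1 / real (Suc n) < Fv G P" for n
    using less_cSup_iff[OF D bdd, of "s - 1 / real (Suc n)"] by (simp add: s_def)
  then obtain P where P: "\<And>n. P n \<in> ?D" "\<And>n. s - 1 / real (Suc n) < Fv G (P n)" by metis
  obtain r R where r: "strict_mono r" and R: "R \<in> ?D" and lim: "(\<lambda>n. tv_dist (P (r n)) R) \<longlonglongrightarrow> 0"
    by (rule dists_convergent_subsequence[OF pair_graph_finite[OF G] P(1)])
  have "s \<le> Fv G R"
  proof (rule field_le_epsilon)
    fix \<delta> :: real assume d: "\<delta> > 0"
    \<comment> \<open>One half of the tolerance pays for replacing \<open>P (r n)\<close> by its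
      limit, the other for its distance from the supremum.\<close>
    then obtain \<rho> where \<rho>: "0 < \<rho>"
      "\<And>P Q. P \<in> ?D \<Longrightarrow> Q \<in> ?D \<Longrightarrow> tv_dist P Q < \<rho> \<Longrightarrow> Fv G P \<le> Fv G Q + \<delta> / 2"
      using uniformly_continuous[OF G, of "\<delta> / 2"] by auto
    have ev1: "\<forall>\<^sub>F n in sequentially. tv_dist (P (r n)) R < \<rho>"
      using order_tendstoD(2)[OF lim \<rho>(1)] .
    have "(\<lambda>n. 1 / real (Suc n)) \<longlonglongrightarrow> 0" by real_asymp
    then have "(\<lambda>n. 1 / real (Suc (r n))) \<longlonglongrightarrow> 0"
      using LIMSEQ_subseq_LIMSEQ[OF _ r] unfolding comp_def by blast
    then have ev2: "\<forall>\<^sub>F n in sequentially. 1 / real (Suc (r n)) < \<delta> / 2"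
      by (rule order_tendstoD) (use d in simp)
    obtain n where "tv_dist (P (r n)) R < \<rho>" "1 / real (Suc (r n)) < \<delta> / 2"
      using eventually_happens[OF eventually_conj[OF ev1 ev2]] by auto
    with \<rho>(2)[OF P(1)[of "r n"] R] P(2)[of "r n"] show "s \<le> Fv G R + \<delta>" by linarith
  qed
  moreover have "Fv G Q \<le> s" if "Q \<in> ?D" for Q
    unfolding s_def using that bdd by (intro cSup_upper) auto
  ultimately show thesis by (intro that[OF R]) (meson order_trans)
qed

section \<open>The functional \<open>f\<close> belongs to the asymptotic spectrum\<close>

abbreviation val :: "'a pair_pre_digraph \<Rightarrow> real" where
  "val G \<equiv> induced_functional F (gclass G)"

lemma val_empty:
  assumes "pair_graph G" "pverts G = {}"
  shows "val G = 0"
proof -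
  obtain G' :: "nat pair_pre_digraph" and \<phi> where "pair_graph G'" "graph_iso \<phi> G G'"
    using exists_nat_copy[OF assms(1)] by blast
  moreover from this have "pverts G' = {}" using graph_iso_image[of \<phi> G G'] assms(2) by simp
  ultimately have "\<exists>G\<in>gclass G. pverts G = {}" by (auto simp: gclass_def)
  then show ?thesis by (simp add: induced_functional_def)
qed

text \<open>\<open>induced_functional\<close> ranges over all representatives of the class on
  natural numbers. A maximum on \<open>G\<close> is pushed forward to one of them to show that it is
  attained, and competitors on any of them are pulled back to \<open>G\<close>.\<close>

lemma val_eqI:
  assumes G: "pair_graph G" and P: "P \<in> dists (pverts G)"
    and max: "\<And>Q. Q \<in> dists (pverts G) \<Longrightarrow> Fv G Q \<le> Fv G P"
  shows "val G = 2 powr Fv G P"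
proof -
  let ?A = "{2 powr F (pgclass H Q) |H Q. H \<in> gclass G \<and> Q \<in> dists (pverts H)}"
  have ne: "\<not> (\<exists>H\<in>gclass G. pverts H = {})"
    using dists_nonempty[OF P] graph_iso_image by (fastforce simp: gclass_def)
  have "(GREATEST y. y \<in> ?A) = 2 powr Fv G P"
  proof (rule Greatest_equality)
    obtain G' :: "nat pair_pre_digraph" and \<phi> where G': "pair_graph G'" "graph_iso \<phi> G G'"
      using exists_nat_copy[OF G] by blast
    then have "G' \<in> gclass G" by (auto simp: gclass_def)
    moreover have "map_pmf \<phi> P \<in> dists (pverts G')" by (rule graph_iso_dists[OF G'(2) P])
    moreover have "F (pgclass G' (map_pmf \<phi> P)) = Fv G P"
      using Fv_iso[OF G'(2) P] by (simp add: Fv_def)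
    ultimately show "2 powr Fv G P \<in> ?A" by (auto intro!: exI[of _ G'] exI[of _ "map_pmf \<phi> P"])
  next
    fix y assume "y \<in> ?A"
    then obtain H Q where y: "y = 2 powr Fv H Q" and H: "H \<in> gclass G" and Q: "Q \<in> dists (pverts H)"
      unfolding Fv_def by blast
    obtain \<phi> where iso: "graph_iso \<phi> G H" using H unfolding gclass_def by blast
    have "Fv H Q = Fv G (map_pmf (inv_into (pverts G) \<phi>) Q)"
      using Fv_iso[OF graph_iso_inv[OF iso] Q] by simp
    also have "\<dots> \<le> Fv G P" by (rule max[OF graph_iso_dists[OF graph_iso_inv[OF iso] Q]])
    finally show "y \<le> 2 powr Fv G P" by (simp add: y)
  qed
  with ne show ?thesis by (simp add: induced_functional_def)
qed

lemma val_attained: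
  assumes G: "pair_graph G" and ne: "pverts G \<noteq> {}"
  obtains P where "P \<in> dists (pverts G)" "val G = 2 powr Fv G P"
    "\<And>Q. Q \<in> dists (pverts G) \<Longrightarrow> Fv G Q \<le> Fv G P"
  using attains_maximum[OF G ne] val_eqI[OF G] by metis

lemma val_ge: "pair_graph G \<Longrightarrow> P \<in> dists (pverts G) \<Longrightarrow> 2 powr Fv G P \<le> val G"
  using val_attained[of G] dists_nonempty[of P] by (metis one_le_numeral powr_mono)

lemma val_nonneg: "pair_graph G \<Longrightarrow> 0 \<le> val G"
  using val_attained[of G] val_empty[of G] by (metis order_refl powr_ge_zero)

text \<open>(P3) covers nonempty summands only; an empty one is absorbed by an isomorphism.
  Otherwise maximising over the components and then over the weight gives
  \<open>log (2^a + 2^b)\<close>, attained at the Gibbs weight.\<close>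

lemma val_sum:
  assumes G: "pair_graph G" and H: "pair_graph H"
  shows "val (G \<squnion>\<^sub>G H) = val G + val H"
proof -
  have arcs: "parcs G \<subseteq> pverts G \<times> pverts G" "parcs H \<subseteq> pverts H \<times> pverts H"
    using G H by (simp_all add: pair_graph_iff)
  consider "pverts G = {}" | "pverts H = {}" | "pverts G \<noteq> {}" "pverts H \<noteq> {}" by blast
  then show ?thesis
  proof cases
    case 1
    then have "graph_iso Inr H (G \<squnion>\<^sub>G H)"
      using arcs by (auto simp: graph_iso_def bij_betw_def disjoint_sum_arcs)
    from gclass_iso[OF this] show ?thesis using val_empty[OF G 1] by simp
  next
    case 2
    then have "graph_iso Inl G (G \<squnion>\<^sub>G H)"
      using arcs by (auto simp: graph_iso_def bij_betw_def disjoint_sum_arcs)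
    from gclass_iso[OF this] show ?thesis using val_empty[OF H 2] by simp
  next
    case 3
    obtain P where P: "P \<in> dists (pverts G)" "val G = 2 powr Fv G P"
      "\<And>Q. Q \<in> dists (pverts G) \<Longrightarrow> Fv G Q \<le> Fv G P" using val_attained[OF G 3(1)] by blast
    obtain Q where Q: "Q \<in> dists (pverts H)" "val H = 2 powr Fv H Q"
      "\<And>P. P \<in> dists (pverts H) \<Longrightarrow> Fv H P \<le> Fv H Q" using val_attained[OF H 3(2)] by blast
    let ?a = "Fv G P" and ?b = "Fv H Q"
    define p where "p = 2 powr ?a / (2 powr ?a + 2 powr ?b)"
    note p = gibbs_binary_eq[of ?a ?b, folded p_def]
    have F: "Fv (G \<squnion>\<^sub>G H) (oplus_pmf p P Q) = log 2 (2 powr ?a + 2 powr ?b)"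
      using sum_eq[OF G H P(1) Q(1) p(1,2)] p(3) by simp
    have "val (G \<squnion>\<^sub>G H) = 2 powr Fv (G \<squnion>\<^sub>G H) (oplus_pmf p P Q)"
    proof (rule val_eqI[OF pair_graph_sum[OF G H]])
      show "oplus_pmf p P Q \<in> dists (pverts (G \<squnion>\<^sub>G H))" using P(1) Q(1) by (simp add: oplus_pmf_dists)
      fix R assume "R \<in> dists (pverts (G \<squnion>\<^sub>G H))"
      then obtain q P' Q' where q: "0 \<le> q" "q \<le> 1" and PQ: "P' \<in> dists (pverts G)" "Q' \<in> dists (pverts H)"
        and R: "R = oplus_pmf q P' Q'" using oplus_pmf_cases[of R, OF _ 3] by auto
      have "Fv (G \<squnion>\<^sub>G H) R = q * Fv G P' + (1 - q) * Fv H Q' + binary_entropy q"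
        unfolding R by (rule sum_eq[OF G H PQ q])
      also have "\<dots> \<le> q * ?a + (1 - q) * ?b + binary_entropy q"
        using P(3)[OF PQ(1)] Q(3)[OF PQ(2)] q by (intro add_mono mult_left_mono) auto
      also have "\<dots> \<le> log 2 (2 powr ?a + 2 powr ?b)" by (rule gibbs_binary[OF q])
      finally show "Fv (G \<squnion>\<^sub>G H) R \<le> Fv (G \<squnion>\<^sub>G H) (oplus_pmf p P Q)" by (simp add: F)
    qed
    also have "\<dots> = val G + val H" unfolding F P(2) Q(2) by (simp add: add_pos_pos)
    finally show ?thesis .
  qed
qed

text \<open>Independence makes the entropy correction in (P2) vanish.\<close>

lemma pair_ge:
  assumes G: "pair_graph G" and H: "pair_graph H" and PQ: "P \<in> dists (pverts G)" "Q \<in> dists (pverts H)"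
  shows "Fv G P + Fv H Q \<le> Fv (G \<boxtimes> H) (pair_pmf P Q)"
proof -
  have "pair_pmf P Q \<in> dists (pverts G \<times> pverts H)" using PQ by (auto simp: dists_def)
  from product_ge[OF G H this] show ?thesis
    using shannon_entropy_pair[OF pair_graph_finite_set_pmf[OF G PQ(1)] pair_graph_finite_set_pmf[OF H PQ(2)]]
    by (simp add: map_fst_pair_pmf map_snd_pair_pmf)
qed

text \<open>At the product of the two maximisers the inequalities of (P2) meet, while the first of
  them bounds every other distribution through its marginals.\<close>

lemma val_product:
  assumes G: "pair_graph G" and H: "pair_graph H"
  shows "val (G \<boxtimes> H) = val G * val H"
proof -
  note GH = pair_graph_product[OF G H]
  show ?thesis
  proof (cases "pverts G = {} \<or> pverts H = {}")
    case True
    then have "val (G \<boxtimes> H) = 0" by (intro val_empty[OF GH]) auto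
    with True show ?thesis using val_empty[OF G] val_empty[OF H] by auto
  next
    case False
    obtain P where P: "P \<in> dists (pverts G)" "val G = 2 powr Fv G P"
      "\<And>Q. Q \<in> dists (pverts G) \<Longrightarrow> Fv G Q \<le> Fv G P" using val_attained[OF G] False by blast
    obtain Q where Q: "Q \<in> dists (pverts H)" "val H = 2 powr Fv H Q"
      "\<And>P. P \<in> dists (pverts H) \<Longrightarrow> Fv H P \<le> Fv H Q" using val_attained[OF H] False by blast
    have le: "Fv (G \<boxtimes> H) R \<le> Fv G P + Fv H Q" if "R \<in> dists (pverts (G \<boxtimes> H))" for R
    proof -
      have R: "R \<in> dists (pverts G \<times> pverts H)" using that by simp
      then have "map_pmf fst R \<in> dists (pverts G)" "map_pmf snd R \<in> dists (pverts H)"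
        by (auto simp: dists_def)
      then show ?thesis using product_le[OF G H R] P(3) Q(3) by fastforce
    qed
    have d: "pair_pmf P Q \<in> dists (pverts (G \<boxtimes> H))" using P(1) Q(1) by (auto simp: dists_def)
    have F: "Fv (G \<boxtimes> H) (pair_pmf P Q) = Fv G P + Fv H Q"
      using le[OF d] pair_ge[OF G H P(1) Q(1)] by simp
    have "val (G \<boxtimes> H) = 2 powr Fv (G \<boxtimes> H) (pair_pmf P Q)"
      by (rule val_eqI[OF GH d]) (use le F in simp)
    then show ?thesis by (simp add: F P(2) Q(2) powr_add)
  qed
qed

lemma val_mono:
  assumes G: "pair_graph G" and H: "pair_graph H" and hom: "graph_hom \<phi> (graph_compl H) (graph_compl G)"
  shows "val H \<le> val G"
proof (cases "pverts H = {}")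
  case True
  then show ?thesis using val_empty[OF H] val_nonneg[OF G] by simp
next
  case False
  obtain P where P: "P \<in> dists (pverts H)" "val H = 2 powr Fv H P" using val_attained[OF H False] by blast
  have "2 powr Fv H P \<le> 2 powr Fv G (map_pmf \<phi> P)"
    using hom_le[OF G H hom P(1)] by simp
  also have "\<dots> \<le> val G"
    using graph_hom_dists[OF hom] P(1) by (intro val_ge[OF G]) simp
  finally show ?thesis by (simp add: P(2))
qed

lemma val_K1: "val K1 = 1"
proof -
  have "P = return_pmf 0" if "P \<in> dists (pverts K1)" for P
    using that by (simp add: dists_def set_pmf_subset_singleton)
  then have "val K1 = 2 powr Fv K1 (return_pmf 0)"
    by (intro val_eqI pair_graph_K1) (auto simp: dists_def)
  then show ?thesis by (simp add: Fv_K1)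
qed

lemma in_asymptotic_spectrum: "induced_functional F \<in> asymptotic_spectrum"
  unfolding asymptotic_spectrum_def
  using val_nonneg val_sum val_product val_mono val_K1 by blast

end

section \<open>Strong powers and types\<close>

lemma strings_0 [simp]: "strings 0 X = {[]}"
  by (auto simp: strings_def)

lemma strings_of_types_subset: "strings_of_types n X U \<subseteq> strings n X"
  by (auto simp: strings_of_types_def strings_of_type_def)

text \<open>A string of positive length determines its type, namely its letter frequencies, so the
  union over types becomes a condition on the string. The factor 2 undoes the half in
  \<open>tv_dist\<close>.\<close>

lemma strings_of_types_tv_ball_iff:
  assumes fin: "finite X" and P: "P \<in> dists X" and n: "n > 0" and xs: "xs \<in> strings n X"
  shows "xs \<in> strings_of_types n X (tv_ball X \<epsilon> P)
    \<longleftrightarrow> (\<Sum>x\<in>X. \<bar>real (count_list xs x) / real n - pmf P x\<bar>) < 2 * \<epsilon>"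
proof
  assume "xs \<in> strings_of_types n X (tv_ball X \<epsilon> P)"
  then obtain Q where Q: "Q \<in> dists X" "tv_dist P Q < \<epsilon>"
    and c: "\<And>x. x \<in> X \<Longrightarrow> real (count_list xs x) = real n * pmf Q x"
    by (auto simp: strings_of_types_def strings_of_type_def tv_ball_def)
  have "(\<Sum>x\<in>X. \<bar>real (count_list xs x) / real n - pmf P x\<bar>) = (\<Sum>x\<in>X. \<bar>pmf P x - pmf Q x\<bar>)"
    using n by (intro sum.cong) (simp_all add: c abs_minus_commute)
  then show "(\<Sum>x\<in>X. \<bar>real (count_list xs x) / real n - pmf P x\<bar>) < 2 * \<epsilon>"
    using Q(2) tv_dist_superset[OF fin P Q(1)] by simp
next
  assume s: "(\<Sum>x\<in>X. \<bar>real (count_list xs x) / real n - pmf P x\<bar>) < 2 * \<epsilon>"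
  have len: "length xs = n" "set xs \<subseteq> X" using xs by (auto simp: strings_def)
  then have ne: "mset xs \<noteq> {#}" using n by auto
  define Q where "Q = pmf_of_multiset (mset xs)"
  have pQ: "pmf Q x = real (count_list xs x) / real n" for x
    using ne len by (simp add: Q_def count_mset)
  have Q: "Q \<in> dists X" using ne len by (simp add: Q_def dists_def)
  have "(\<Sum>x\<in>X. \<bar>pmf P x - pmf Q x\<bar>) < 2 * \<epsilon>" using s by (simp add: pQ abs_minus_commute)
  then have "Q \<in> tv_ball X \<epsilon> P"
    using Q tv_dist_superset[OF fin P Q] by (simp add: tv_ball_def)
  moreover have "is_ntype n X Q" using Q n by (simp add: is_ntype_def pQ)
  moreover have "xs \<in> strings_of_type n X Q" using xs n by (simp add: strings_of_type_def pQ)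
  ultimately show "xs \<in> strings_of_types n X (tv_ball X \<epsilon> P)"
    by (auto simp: strings_of_types_def)
qed

section \<open>Concentration of types of independent letters\<close>

lemma map_eq_bernoulli_pmf: "map_pmf (\<lambda>y. y = x) P = bernoulli_pmf (pmf P x)"
proof (rule pmf_eqI)
  fix b :: bool
  have t: "pmf (map_pmf (\<lambda>y. y = x) P) True = pmf P x"
  proof -
    have "(\<lambda>y. y = x) -` {True} = {x}" by auto
    then show ?thesis by (simp add: pmf_map measure_pmf_single)
  qed
  show "pmf (map_pmf (\<lambda>y. y = x) P) b = pmf (bernoulli_pmf (pmf P x)) b"
    using t by (cases b) (simp_all add: pmf_False_conv_True pmf_le_1)
qed

text \<open>Turns the deviation of one letter frequency into a binomial tail, to which Hoeffding's
  inequality applies.\<close>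

lemma map_count_replicate_pmf:
  "map_pmf (\<lambda>xs. count_list xs x) (replicate_pmf n P) = binomial_pmf n (pmf P x)"
proof (induction n)
  case 0
  then show ?case by (simp add: binomial_pmf_0 pmf_le_1)
next
  case (Suc n)
  have "map_pmf (\<lambda>xs. count_list xs x) (replicate_pmf (Suc n) P)
      = bind_pmf P (\<lambda>y. map_pmf (\<lambda>k. (if y = x then 1 else 0) + k)
          (map_pmf (\<lambda>xs. count_list xs x) (replicate_pmf n P)))"
    by (auto simp: map_bind_pmf map_pmf_comp bind_return_pmf map_pmf_def[symmetric] intro!: bind_pmf_cong map_pmf_cong)
  also have "\<dots> = bind_pmf (map_pmf (\<lambda>y. y = x) P)
      (\<lambda>b. map_pmf (\<lambda>k. (if b then 1 else 0) + k) (binomial_pmf n (pmf P x)))"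
    unfolding Suc bind_map_pmf ..
  also have "\<dots> = binomial_pmf (Suc n) (pmf P x)"
    unfolding map_eq_bernoulli_pmf by (simp add: binomial_pmf_Suc pmf_le_1 map_pmf_def)
  finally show ?case .
qed

lemma replicate_pmf_dists: "P \<in> dists X \<Longrightarrow> replicate_pmf n P \<in> dists (strings n X)"
  by (auto simp: dists_def set_replicate_pmf strings_def lists_eq_set)

lemma prob_strings_of_types:
  assumes fin: "finite X" and P: "P \<in> dists X" and e: "\<epsilon> > 0"
  shows "(\<lambda>n. measure_pmf.prob (replicate_pmf n P) (strings_of_types n X (tv_ball X \<epsilon> P))) \<longlonglongrightarrow> 1"
proof (rule tendsto_sandwich[where h = "\<lambda>_. 1"])
  define m where "m = real (card X)"
  have m: "m > 0" using fin dists_nonempty[OF P] by (simp add: m_def card_gt_0_iff)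
  \<comment> \<open>If every letter frequency deviates by less than \<open>d\<close>, the sum of the
    deviations is at most \<open>m * d = \<epsilon>\<close>, hence strictly below the required
    \<open>2 * \<epsilon>\<close>. The union bound then costs only a factor
    \<open>m\<close>.\<close>
  define d where "d = \<epsilon> / m"
  have d: "d > 0" using e m by (simp add: d_def)
  let ?T = "\<lambda>n. strings_of_types n X (tv_ball X \<epsilon> P)"
  let ?B = "\<lambda>n x. {xs. \<bar>real (count_list xs x) / real n - pmf P x\<bar> \<ge> d}"
  have bad: "measure_pmf.prob (replicate_pmf n P) (?B n x) \<le> 2 * exp (-2 * real n * d\<^sup>2)" if n: "n > 0" for n x
  proof -
    interpret binomial_distribution n "pmf P x"
      by unfold_locales (simp add: pmf_le_1)
    have "measure_pmf.prob (replicate_pmf n P) (?B n x)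
        = measure_pmf.prob (map_pmf (\<lambda>xs. count_list xs x) (replicate_pmf n P))
            {k. \<bar>real k / real n - pmf P x\<bar> \<ge> d}"
      by (simp add: vimage_def)
    also have "\<dots> \<le> 2 * exp (-2 * real n * d\<^sup>2)"
      unfolding map_count_replicate_pmf using prob_abs_ge'[OF n] d by simp
    finally show ?thesis .
  qed
  have good: "xs \<in> ?T n" if n: "n > 0" and xs: "xs \<in> strings n X" and "\<forall>x\<in>X. xs \<notin> ?B n x" for n xs
  proof -
    have "(\<Sum>x\<in>X. \<bar>real (count_list xs x) / real n - pmf P x\<bar>) \<le> (\<Sum>x\<in>X. d)"
      using that(3) by (intro sum_mono) fastforce
    also have "\<dots> = \<epsilon>" using m by (simp add: d_def m_def)
    also have "\<dots> < 2 * \<epsilon>" using e by simp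
    finally show ?thesis using strings_of_types_tv_ball_iff[OF fin P n xs] by simp
  qed
  show "\<forall>\<^sub>F n in sequentially. 1 - m * (2 * exp (-2 * real n * d\<^sup>2))
      \<le> measure_pmf.prob (replicate_pmf n P) (?T n)"
    using eventually_gt_at_top[of 0]
  proof eventually_elim
    case (elim n)
    let ?R = "replicate_pmf n P"
    have "1 - measure_pmf.prob ?R (?T n) = measure_pmf.prob ?R (- ?T n)"
      using measure_pmf.prob_compl[of "?T n" ?R] by (simp add: Compl_eq_Diff_UNIV)
    also have "\<dots> \<le> measure_pmf.prob ?R (\<Union>x\<in>X. ?B n x)"
    proof (rule measure_pmf.finite_measure_mono_AE)
      show "AE xs in measure_pmf ?R. xs \<in> - ?T n \<longrightarrow> xs \<in> (\<Union>x\<in>X. ?B n x)"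
        using good[OF elim] replicate_pmf_dists[OF P, of n] by (fastforce simp: AE_measure_pmf_iff dists_def)
    qed simp
    also have "\<dots> \<le> (\<Sum>x\<in>X. measure_pmf.prob ?R (?B n x))"
      by (rule measure_pmf.finite_measure_subadditive_finite) (use fin in auto)
    also have "\<dots> \<le> (\<Sum>x\<in>X. 2 * exp (-2 * real n * d\<^sup>2))"
      by (intro sum_mono bad[OF elim])
    also have "\<dots> = m * (2 * exp (-2 * real n * d\<^sup>2))" by (simp add: m_def)
    finally show ?case by simp
  qed
  show "(\<lambda>n. 1 - m * (2 * exp (-2 * real n * d\<^sup>2))) \<longlonglongrightarrow> 1"
    using d by real_asymp
qed simp_all

lemma root_two_powr:
  assumes "n > 0"
  shows "root n (2 powr (real n * c)) = 2 powr c"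
proof -
  have "(2 powr c) ^ n = (2::real) powr (real n * c)"
    by (simp add: powr_realpow[symmetric] powr_powr mult.commute)
  then show ?thesis using assms by (metis powr_ge_zero real_root_pos_unique)
qed

section \<open>Two-sided estimates on strong powers\<close>

context probabilistic_refinement
begin

text \<open>(P2) splits off the first letter, and concavity merges its marginal with the average for
  the tail. The expected counts are recorded because they tie \<open>R\<close> to the types of the
  strings in the support of \<open>Q\<close>.\<close>

lemma power_le:
  assumes G: "pair_graph G" and ne: "pverts G \<noteq> {}" and Q: "Q \<in> dists (strings n (pverts G))"
  shows "\<exists>R\<in>dists (pverts G). Fv (strong_power G n) Q \<le> real n * Fv G R \<and>
    (\<forall>x. real n * pmf R x = measure_pmf.expectation Q (\<lambda>xs. real (count_list xs x)))"
  using Q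
proof (induction n arbitrary: Q)
  case 0
  obtain v where v: "v \<in> pverts G" using ne by blast
  have Q: "Q = return_pmf []" using 0 by (simp add: dists_def set_pmf_subset_singleton)
  have "graph_iso (\<lambda>_. []) K1 (strong_power G 0)"
    by (rule graph_iso_singleton[OF pair_graph_power[OF G]]) simp
  from Fv_iso[OF this, of "return_pmf 0"] have "Fv (strong_power G 0) Q = 0"
    by (simp add: Q Fv_K1 dists_def)
  \<comment> \<open>For the empty string both conditions on \<open>R\<close> are multiplied by zero,
    so any point mass will do.\<close>
  then show ?case using v by - (rule bexI[of _ "return_pmf v"], auto simp: Q dists_def)
next
  case (Suc n)
  let ?V = "pverts G" and ?c = "\<lambda>(x, xs). x # xs"
  let ?Q = "map_pmf (\<lambda>xs. (hd xs, tl xs)) Q"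
  have cons: "xs \<noteq> [] \<and> hd xs \<in> ?V \<and> tl xs \<in> strings n ?V" if "xs \<in> set_pmf Q" for xs
  proof -
    have "xs \<in> strings (Suc n) ?V" using that Suc.prems by (auto simp: dists_def)
    then show ?thesis by (cases xs) (auto simp: strings_def)
  qed
  have fin: "finite (set_pmf Q)"
    using pair_graph_finite_set_pmf[OF pair_graph_power[OF G, of "Suc n"], of Q] Suc.prems by simp
  have d: "?Q \<in> dists (?V \<times> strings n ?V)" "map_pmf hd Q \<in> dists ?V" "map_pmf tl Q \<in> dists (strings n ?V)"
    using cons by (auto simp: dists_def)
  obtain R where R: "R \<in> dists ?V" "Fv (strong_power G n) (map_pmf tl Q) \<le> real n * Fv G R"
    and Rc: "\<And>x. real n * pmf R x = measure_pmf.expectation (map_pmf tl Q) (\<lambda>xs. real (count_list xs x))"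
    using Suc.IH[OF d(3)] by blast
  \<comment> \<open>The weight that gives all \<open>n + 1\<close> positions an equal share:
    \<open>R\<close> already averages \<open>n\<close> of them.\<close>
  let ?t = "1 / real (Suc n)"
  let ?R = "mix_pmf ?t (map_pmf hd Q) R"
  have avg: "real (Suc n) * (?t * a + (1 - ?t) * b) = a + real n * b" for a b
  proof -
    have "N * (1 / N * a + (1 - 1 / N) * b) = a + (N - 1) * b" if "N \<noteq> 0" for N :: real
      using that by (simp add: field_simps)
    from this[of "real (Suc n)"] show ?thesis by simp
  qed
  have "map_pmf ?c ?Q = Q" unfolding map_pmf_comp using cons by (intro map_pmf_idI) simp
  then have "Fv (strong_power G (Suc n)) Q = Fv (G \<boxtimes> strong_power G n) ?Q"
    using Fv_iso[OF graph_iso_power_Suc[of G n], of ?Q] d(1) by simp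
  also have "\<dots> \<le> Fv G (map_pmf hd Q) + Fv (strong_power G n) (map_pmf tl Q)"
    using product_le[OF G pair_graph_power[OF G, of n], of ?Q] d(1) by (simp add: map_pmf_comp)
  also have "\<dots> \<le> real (Suc n) * (?t * Fv G (map_pmf hd Q) + (1 - ?t) * Fv G R)"
    unfolding avg using R(2) by simp
  also have "\<dots> \<le> real (Suc n) * Fv G ?R"
    by (intro mult_left_mono concave[OF G d(2) R(1)]) auto
  finally have F: "Fv (strong_power G (Suc n)) Q \<le> real (Suc n) * Fv G ?R" .
  have "real (Suc n) * pmf ?R x = measure_pmf.expectation Q (\<lambda>xs. real (count_list xs x))" for x
  proof -
    have "real (Suc n) * pmf ?R x = pmf (map_pmf hd Q) x + real n * pmf R x"
      using avg[of "pmf (map_pmf hd Q) x" "pmf R x"] by (subst pmf_mix_pmf) auto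
    also have "\<dots> = measure_pmf.expectation Q (indicator (hd -` {x}))
        + measure_pmf.expectation Q (\<lambda>xs. real (count_list (tl xs) x))"
      by (simp add: Rc pmf_map)
    also have "\<dots> = measure_pmf.expectation Q (\<lambda>xs. indicator (hd -` {x}) xs + real (count_list (tl xs) x))"
      by (rule Bochner_Integration.integral_add[symmetric]; rule integrable_measure_pmf_finite[OF fin])
    also have "\<dots> = measure_pmf.expectation Q (\<lambda>xs. real (count_list xs x))"
    proof (rule integral_cong_AE)
      have "indicator (hd -` {x}) xs + real (count_list (tl xs) x) = real (count_list xs x)"
        if "xs \<in> set_pmf Q" for xs
        using cons[OF that] by (cases xs) (auto simp: indicator_def)
      then show "AE xs in measure_pmf Q. indicator (hd -` {x}) xs + real (count_list (tl xs) x) = real (count_list xs x)"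
        by (simp add: AE_measure_pmf_iff)
    qed simp_all
    finally show ?thesis .
  qed
  with F show ?case by (intro bexI[of _ ?R]) (use d(2) R(1) in \<open>auto intro: mix_pmf_dists\<close>)
qed

text \<open>The letters of \<open>replicate_pmf n P\<close> are independent, so
  \<open>pair_ge\<close> adds one \<open>F(G, P)\<close> per letter.\<close>

lemma power_ge:
  assumes G: "pair_graph G" and P: "P \<in> dists (pverts G)"
  shows "real n * Fv G P \<le> Fv (strong_power G n) (replicate_pmf n P)"
proof (induction n)
  case 0
  show ?case
    using nonneg[OF pair_graph_power[OF G], of "return_pmf []" 0] by (simp add: dists_def)
next
  case (Suc n)
  note r = replicate_pmf_dists[OF P, of n]
  have e: "map_pmf (\<lambda>(x, xs). x # xs) (pair_pmf P (replicate_pmf n P)) = replicate_pmf (Suc n) P"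
    by (simp add: pair_pmf_def map_bind_pmf)
  have "real (Suc n) * Fv G P \<le> Fv G P + Fv (strong_power G n) (replicate_pmf n P)"
    using Suc by (simp add: algebra_simps)
  also have "\<dots> \<le> Fv (G \<boxtimes> strong_power G n) (pair_pmf P (replicate_pmf n P))"
    by (rule pair_ge[OF G pair_graph_power[OF G] P]) (use r in simp)
  also have "\<dots> = Fv (strong_power G (Suc n)) (replicate_pmf (Suc n) P)"
  proof -
    have "pair_pmf P (replicate_pmf n P) \<in> dists (pverts (G \<boxtimes> strong_power G n))"
      using P r by (auto simp: dists_def)
    from Fv_iso[OF graph_iso_power_Suc this] show ?thesis unfolding e by (rule sym)
  qed
  finally show ?case .
qed

text \<open>The average \<open>R\<close> of the marginals of a distribution on \<open>T\<close> is the mean of the types of the strings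
  in \<open>T\<close>, so it lies in the closed ball.\<close>

lemma val_types_le:
  assumes G: "pair_graph G" and P: "P \<in> dists (pverts G)" and n: "n > 0"
    and c: "\<And>R. R \<in> dists (pverts G) \<Longrightarrow> tv_dist R P \<le> \<epsilon> \<Longrightarrow> Fv G R \<le> c"
  shows "root n (val (induced_subgraph_on (strong_power G n)
           (strings_of_types n (pverts G) (tv_ball (pverts G) \<epsilon> P)))) \<le> 2 powr c"
proof -
  let ?V = "pverts G"
  let ?T = "strings_of_types n ?V (tv_ball ?V \<epsilon> P)"
  let ?H = "induced_subgraph_on (strong_power G n) ?T"
  note Gn = pair_graph_power[OF G, of n]
  note H = pair_graph_induced[OF Gn, of ?T]
  note fin = pair_graph_finite[OF G]
  have T: "strings n ?V \<inter> ?T = ?T" using strings_of_types_subset[of n ?V] by blast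
  have "val ?H \<le> 2 powr (real n * c)"
  proof (cases "?T = {}")
    case True
    then show ?thesis using val_empty[OF H] by simp
  next
    case False
    then obtain Q where Q: "Q \<in> dists ?T" "val ?H = 2 powr Fv ?H Q"
      using val_attained[OF H] by (auto simp: T)
    have QT: "xs \<in> ?T" "xs \<in> strings n ?V" if "xs \<in> set_pmf Q" for xs
      using that Q(1) T by (auto simp: dists_def)
    have QV: "Q \<in> dists (strings n ?V)" using QT by (auto simp: dists_def)
    have finQ: "finite (set_pmf Q)" using pair_graph_finite_set_pmf[OF Gn] QV by simp
    have "Fv ?H Q = Fv (strong_power G n) Q" by (rule Fv_induced[OF Gn]) (use Q(1) T in simp)
    moreover obtain R where R: "R \<in> dists ?V" "Fv (strong_power G n) Q \<le> real n * Fv G R"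
      and Rc: "\<And>x. real n * pmf R x = measure_pmf.expectation Q (\<lambda>xs. real (count_list xs x))"
      using power_le[OF G dists_nonempty[OF P] QV] by blast
    moreover have "tv_dist R P \<le> \<epsilon>"
    proof -
      let ?g = "\<lambda>xs x. real (count_list xs x) / real n - pmf P x"
      note int = integrable_measure_pmf_finite[OF finQ]
      \<comment> \<open>At each letter, the deviation of \<open>R\<close> is the mean deviation of
        the letter frequencies. Taking absolute values inside the expectation leaves a sum that is
        below \<open>2 * \<epsilon>\<close> for every string in the support.\<close>
      have "pmf R x - pmf P x = measure_pmf.expectation Q (\<lambda>xs. ?g xs x)" for x
        using Rc[of x] n by (subst Bochner_Integration.integral_diff[OF int int]) (simp add: field_simps)
      then have "(\<Sum>x\<in>?V. \<bar>pmf R x - pmf P x\<bar>) \<le> (\<Sum>x\<in>?V. measure_pmf.expectation Q (\<lambda>xs. \<bar>?g xs x\<bar>))"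
        by (intro sum_mono) (simp add: integral_abs_bound)
      also have "\<dots> = measure_pmf.expectation Q (\<lambda>xs. \<Sum>x\<in>?V. \<bar>?g xs x\<bar>)"
        by (rule Bochner_Integration.integral_sum[symmetric]) (rule int)
      also have "\<dots> \<le> measure_pmf.expectation Q (\<lambda>_. 2 * \<epsilon>)"
      proof (rule integral_mono_AE[OF int int])
        show "AE xs in measure_pmf Q. (\<Sum>x\<in>?V. \<bar>?g xs x\<bar>) \<le> 2 * \<epsilon>"
          using strings_of_types_tv_ball_iff[OF fin P n] QT
          by (auto simp: AE_measure_pmf_iff less_imp_le)
      qed
      finally show ?thesis by (simp add: tv_dist_superset[OF fin R(1) P])
    qed
    ultimately have "Fv ?H Q \<le> real n * c"
      using c[OF R(1)] by (smt (verit) mult_left_mono of_nat_0_le_iff)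
    then show ?thesis by (simp add: Q(2))
  qed
  then have "root n (val ?H) \<le> root n (2 powr (real n * c))" using n by simp
  then show ?thesis by (simp add: root_two_powr[OF n])
qed

text \<open>\<open>P^n\<close> is split according to membership in the set of typical strings. The
  typical part gives a lower bound for \<open>f\<close>, the atypical part has vanishing weight, and
  the choice between them costs at most one bit.\<close>

lemma val_types_ge:
  assumes G: "pair_graph G" and P: "P \<in> dists (pverts G)" and e: "\<epsilon> > 0"
  obtains c where "c \<longlonglongrightarrow> 0"
    "\<forall>\<^sub>F n in sequentially. 2 powr (Fv G P - c n) \<le> root n (val (induced_subgraph_on (strong_power G n)
           (strings_of_types n (pverts G) (tv_ball (pverts G) \<epsilon> P))))"
proof -
  let ?V = "pverts G"
  let ?T = "\<lambda>n. strings_of_types n ?V (tv_ball ?V \<epsilon> P)"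
  let ?H = "\<lambda>n. induced_subgraph_on (strong_power G n) (?T n)"
  define p where "p n = measure_pmf.prob (replicate_pmf n P) (?T n)" for n
  have p: "p \<longlonglongrightarrow> 1" unfolding p_def by (rule prob_strings_of_types[OF pair_graph_finite[OF G] P e])
  obtain M where M: "0 \<le> M" "\<And>P. P \<in> dists ?V \<Longrightarrow> Fv G P \<le> M"
    using bounded_above[OF G] by blast
  \<comment> \<open>The loss per letter: the atypical part contributes at most \<open>n * M\<close>
    with weight \<open>1 - p n\<close>, and 1 bounds \<open>binary_entropy (p n)\<close>; the sum is
    divided by \<open>n\<close>.\<close>
  define c where "c n = (1 - p n) * M + 1 / real n" for n
  have "(\<lambda>n. 1 / real n) \<longlonglongrightarrow> 0" by real_asymp
  then have "c \<longlonglongrightarrow> (1 - 1) * M + 0" unfolding c_def by (intro tendsto_intros p)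
  then have c0: "c \<longlonglongrightarrow> 0" by simp
  have "\<forall>\<^sub>F n in sequentially. p n > 0" by (rule order_tendstoD(1)[OF p]) simp
  then have "\<forall>\<^sub>F n in sequentially. 2 powr (Fv G P - c n) \<le> root n (val (?H n))"
    using eventually_gt_at_top[of 0]
  proof eventually_elim
    case (elim n)
    let ?P = "replicate_pmf n P"
    note Gn = pair_graph_power[OF G, of n]
    note H = pair_graph_induced[OF Gn, of "?T n"]
    have p01: "0 \<le> p n" "p n \<le> 1" by (simp_all add: p_def)
    obtain R R' where split: "?P = mix_pmf (p n) R R'" and R: "set_pmf R \<subseteq> set_pmf ?P \<inter> ?T n"
      and R': "set_pmf R' \<subseteq> set_pmf ?P"
      using mix_pmf_split[of ?P "?T n"] elim unfolding p_def by (metis less_irrefl)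
    have dP: "?P \<in> dists (strings n ?V)" by (rule replicate_pmf_dists[OF P])
    have d: "R \<in> dists (strings n ?V)" "R' \<in> dists (strings n ?V)" "R \<in> dists (strings n ?V \<inter> ?T n)"
      using dP R R' by (auto simp: dists_def)
    \<comment> \<open>Passing through \<open>power_le\<close> gives a bound linear in
      \<open>n\<close>, with the constant \<open>M\<close> of \<open>G\<close> itself.\<close>
    obtain S where S: "S \<in> dists ?V" "Fv (strong_power G n) R' \<le> real n * Fv G S"
      using power_le[OF G dists_nonempty[OF P] d(2)] by blast
    have R'M: "Fv (strong_power G n) R' \<le> real n * M"
      using S(2) M(2)[OF S(1)] by (smt (verit) mult_left_mono of_nat_0_le_iff)
    have "real n * Fv G P \<le> Fv (strong_power G n) ?P" by (rule power_ge[OF G P])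
    also have "\<dots> \<le> p n * Fv (strong_power G n) R + (1 - p n) * Fv (strong_power G n) R' + binary_entropy (p n)"
      unfolding split by (rule almost_convex[OF Gn]) (use d p01 in simp_all)
    \<comment> \<open>Replacing the weight \<open>p n\<close> by 1 is sound because \<open>F\<close>
      is nonnegative.\<close>
    also have "\<dots> \<le> 1 * Fv (strong_power G n) R + (1 - p n) * (real n * M) + 1"
      using p01 nonneg[OF Gn, of R] d(1) R'M binary_entropy_le[OF p01]
      by (intro add_mono mult_right_mono mult_left_mono) auto
    also have "Fv (strong_power G n) R = Fv (?H n) R"
      using Fv_induced[OF Gn, of R "?T n"] d(3) by simp
    finally have "real n * Fv G P \<le> 1 * Fv (?H n) R + (1 - p n) * (real n * M) + 1" .
    moreover have "real n * c n = (1 - p n) * (real n * M) + 1"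
      using elim by (simp add: c_def distrib_left)
    ultimately have "real n * (Fv G P - c n) \<le> Fv (?H n) R" by (simp add: right_diff_distrib)
    then have "2 powr (real n * (Fv G P - c n)) \<le> 2 powr Fv (?H n) R" by simp
    also have "\<dots> \<le> val (?H n)" by (rule val_ge[OF H]) (use d(3) in simp)
    finally have "root n (2 powr (real n * (Fv G P - c n))) \<le> root n (val (?H n))"
      using elim by simp
    then show ?case using elim by (simp add: root_two_powr)
  qed
  with c0 show thesis by (rule that)
qed

lemma limsup_val_types:
  assumes G: "pair_graph G" and P: "P \<in> dists (pverts G)"
  shows "((\<lambda>\<epsilon>. limsup (\<lambda>n. ereal (root n (val (induced_subgraph_on (strong_power G n)
           (strings_of_types n (pverts G) (tv_ball (pverts G) \<epsilon> P)))))))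
         \<longlongrightarrow> ereal (2 powr Fv G P)) (at_right 0)" (is "(?g \<longlongrightarrow> ?L) _")
proof (rule order_tendstoI)
  fix a :: ereal assume a: "a < ?L"
  \<comment> \<open>The lower bound holds at every positive radius; only the upper bound needs small
    radii.\<close>
  have "?L \<le> ?g \<epsilon>" if e: "\<epsilon> > 0" for \<epsilon>
  proof -
    obtain c where c: "c \<longlonglongrightarrow> 0"
      "\<forall>\<^sub>F n in sequentially. 2 powr (Fv G P - c n) \<le> root n (val (induced_subgraph_on (strong_power G n)
           (strings_of_types n (pverts G) (tv_ball (pverts G) \<epsilon> P))))"
      by (rule val_types_ge[OF G P e])
    have "(\<lambda>n. ereal (2 powr (Fv G P - c n))) \<longlonglongrightarrow> ereal (2 powr (Fv G P - 0))"
      by (intro tendsto_intros c) simp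
    from lim_imp_Limsup[OF trivial_limit_sequentially this]
    have "?L = limsup (\<lambda>n. ereal (2 powr (Fv G P - c n)))" by simp
    also have "\<dots> \<le> ?g \<epsilon>"
      by (rule Limsup_mono) (use c(2) in simp)
    finally show ?thesis .
  qed
  then show "\<forall>\<^sub>F \<epsilon> in at_right 0. a < ?g \<epsilon>"
    using a by (auto simp: eventually_at_right_field intro!: exI[of _ 1] less_le_trans[OF a])
next
  fix a :: ereal assume a: "?L < a"
  have "((\<lambda>\<delta>. ereal (2 powr (Fv G P + \<delta>))) \<longlongrightarrow> ereal (2 powr (Fv G P + 0))) (at_right 0)"
    by (intro tendsto_intros) simp
  then have "\<forall>\<^sub>F \<delta> in at_right 0. ereal (2 powr (Fv G P + \<delta>)) < a"
    by (rule order_tendstoD) (use a in simp)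
  then obtain b where b: "b > 0" "\<And>\<delta>. 0 < \<delta> \<Longrightarrow> \<delta> < b \<Longrightarrow> ereal (2 powr (Fv G P + \<delta>)) < a"
    by (auto simp: eventually_at_right_field)
  define \<delta> where "\<delta> = b / 2"
  have \<delta>: "\<delta> > 0" "ereal (2 powr (Fv G P + \<delta>)) < a" using b by (auto simp: \<delta>_def)
  obtain r where r: "0 < r"
    "\<And>R. R \<in> dists (pverts G) \<Longrightarrow> tv_dist R P < r \<Longrightarrow> Fv G R \<le> Fv G P + \<delta>"
    using uniformly_continuous[OF G \<delta>(1)] P by metis
  \<comment> \<open>For \<open>\<epsilon> < r\<close> the closed ball of radius
    \<open>\<epsilon>\<close>, where the averaged marginals lie, is inside the open ball on which
    continuity was established.\<close>
  have "?g \<epsilon> \<le> ereal (2 powr (Fv G P + \<delta>))" if "\<epsilon> < r" for \<epsilon>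
  proof (rule Limsup_bounded)
    show "\<forall>\<^sub>F n in sequentially. ereal (root n (val (induced_subgraph_on (strong_power G n)
           (strings_of_types n (pverts G) (tv_ball (pverts G) \<epsilon> P))))) \<le> ereal (2 powr (Fv G P + \<delta>))"
      using eventually_gt_at_top[of 0]
      by eventually_elim (use r(2) that in \<open>auto intro!: val_types_le[OF G P]\<close>)
  qed
  then show "\<forall>\<^sub>F \<epsilon> in at_right 0. ?g \<epsilon> < a"
    using r(1) \<delta>(2) by (auto simp: eventually_at_right_field intro!: exI[of _ r] intro: le_less_trans)
qed

end

theorem theorem1p2:
  fixes F :: "prob_graph_class \<Rightarrow> real"
  assumes P1: "\<And>(G :: nat pair_pre_digraph) P Q t.
      \<lbrakk>pair_graph G; pverts G \<noteq> {}; P \<in> dists (pverts G); Q \<in> dists (pverts G); 0 \<le> t; t \<le> 1\<rbrakk> \<Longrightarrow>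
      t * F (pgclass G P) + (1 - t) * F (pgclass G Q) \<le> F (pgclass G (mix_pmf t P Q))"
    and P2: "\<And>(G :: nat pair_pre_digraph) (H :: nat pair_pre_digraph) P.
      \<lbrakk>pair_graph G; pair_graph H; pverts G \<noteq> {}; pverts H \<noteq> {};
       P \<in> dists (pverts G \<times> pverts H)\<rbrakk> \<Longrightarrow>
      F (pgclass (G \<boxtimes> H) P)
        \<le> F (pgclass G (map_pmf fst P)) + F (pgclass H (map_pmf snd P)) \<and>
      F (pgclass G (map_pmf fst P)) + F (pgclass H (map_pmf snd P))
        \<le> F (pgclass (G \<boxtimes> H) P) + shannon_entropy (map_pmf fst P)
            + shannon_entropy (map_pmf snd P) - shannon_entropy P"
    and P3: "\<And>(G :: nat pair_pre_digraph) (H :: nat pair_pre_digraph) P Q p.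
      \<lbrakk>pair_graph G; pair_graph H; pverts G \<noteq> {}; pverts H \<noteq> {};
       P \<in> dists (pverts G); Q \<in> dists (pverts H); 0 \<le> p; p \<le> 1\<rbrakk> \<Longrightarrow>
      F (pgclass (G \<squnion>\<^sub>G H) (oplus_pmf p P Q))
        = p * F (pgclass G P) + (1 - p) * F (pgclass H Q) + binary_entropy p"
    and P4: "\<And>(G :: nat pair_pre_digraph) (H :: nat pair_pre_digraph) \<phi> P.
      \<lbrakk>pair_graph G; pair_graph H; graph_hom \<phi> (graph_compl H) (graph_compl G);
       P \<in> dists (pverts H)\<rbrakk> \<Longrightarrow>
      F (pgclass H P) \<le> F (pgclass G (map_pmf \<phi> P))"
  shows "(\<forall>G :: nat pair_pre_digraph. pair_graph G \<longrightarrow> pverts G \<noteq> {} \<longrightarrow>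
            (\<exists>P\<in>dists (pverts G). \<forall>Q\<in>dists (pverts G).
               2 powr F (pgclass G Q) \<le> 2 powr F (pgclass G P)))
       \<and> induced_functional F \<in> asymptotic_spectrum
       \<and> (\<forall>(G :: nat pair_pre_digraph) P. pair_graph G \<longrightarrow> pverts G \<noteq> {} \<longrightarrow> P \<in> dists (pverts G) \<longrightarrow>
            (\<exists>L>0. ((\<lambda>\<epsilon>. limsup (\<lambda>n. ereal (root n (induced_functional F
                       (gclass (induced_subgraph_on (strong_power G n)
                          (strings_of_types n (pverts G) (tv_ball (pverts G) \<epsilon> P))))))))
                     \<longlongrightarrow> ereal L) (at_right 0)
                   \<and> F (pgclass G P) = log 2 L))"
proof -
  interpret probabilistic_refinement F
    by unfold_locales (fact P1 P2 P3 P4)+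
  show ?thesis
  proof (intro conjI allI impI in_asymptotic_spectrum)
    fix G :: "nat pair_pre_digraph" assume G: "pair_graph G" "pverts G \<noteq> {}"
    from attains_maximum[OF G]
    show "\<exists>P\<in>dists (pverts G). \<forall>Q\<in>dists (pverts G). 2 powr F (pgclass G Q) \<le> 2 powr F (pgclass G P)"
      unfolding Fv_def by (metis one_le_numeral powr_mono)
  next
    fix G :: "nat pair_pre_digraph" and P
    assume "pair_graph G" "P \<in> dists (pverts G)"
    from limsup_val_types[OF this, unfolded Fv_def]
    show "\<exists>L>0. ((\<lambda>\<epsilon>. limsup (\<lambda>n. ereal (root n (val (induced_subgraph_on (strong_power G n)
                    (strings_of_types n (pverts G) (tv_ball (pverts G) \<epsilon> P)))))))
                 \<longlongrightarrow> ereal L) (at_right 0) \<and> F (pgclass G P) = log 2 L"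
      by (intro exI[of _ "2 powr F (pgclass G P)"]) simp
  qed
qed

end
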